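(* Suppose that the eigenvalues of $W_\infty=-(W_0+W_1+W_t)$ are $\mp\theta_\infty/2$, where $\pm\theta_\infty$ is not a positive integer. Let $\Phi(\lambda;t)$ be a bounded solution of $$\frac{d\Phi}{d\lambda}=\Bigl(\frac{W_0}{\lambda}+\frac{W_1}{\lambda-1}+\frac{W_t}{\lambda-t}\Bigr)\Phi$$ in $L^2((t,\infty);\lambda^{-1}d\lambda;\mathbf R^2)$, such that $\int_t^\infty\lambda^{-1}\|\Phi(\lambda;t)\|^2\,d\lambda<\infty$, and let $$K(\lambda,\mu;t)=\frac{\langle J\Phi(\lambda;t),\Phi(\mu;t)\rangle}{\lambda-\mu}.$$ (i) Then there exists $\phi\in L^2((0,\infty);\lambda\,d\lambda;\mathbf R^6)$ such that $$K(\lambda,\mu;t)=\int_0^\infty\langle\sigma_{3,3}\,\phi(\lambda+s;t),\phi(\mu+s;t)\rangle\,ds\qquad(\lambda,\mu>t;\ \lambda\neq\mu),$$ and hence $K$ defines a trace class operator on $L^2((t,\infty);d\lambda)$. (ii) The kernel $\dfrac{\partial}{\partial t}K(\lambda,\mu;t)$ is of finite rank in $(\lambda,\mu)$.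
   Context: For $\nu\in\{0,1,t\}$, $$W_\nu=W_\nu(t)=\begin{pmatrix} z_\nu+\theta_\nu/2&-u_\nu z_\nu\\ u_\nu^{-1}(z_\nu+\theta_\nu)&-z_\nu-\theta_\nu/2\end{pmatrix},$$ with parameters $\theta_\nu,z_\nu,u_\nu$; the matrices depend on $t$. The equation for $\Phi$ in the claim is the $\lambda$-equation of the Jimbo–Miwa–Ueno pair, whose other member is $\frac{d\Phi}{dt}=\frac{-W_t}{\lambda-t}\Phi$; the consistency condition of the pair leads to the Painlevé VI equation. The inner products are the standard ones, $J=\begin{pmatrix}0&-1\\1&0\end{pmatrix}$, and $\sigma_{j,k}=\begin{pmatrix}I_j&0\\0&-I_k\end{pmatrix}$. A kernel is of finite rank in $(\lambda,\mu)$ if, for each $t$, it is a finite sum of products of functions of $\lambda$ and functions of $\mu$.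
   Formalization: The literal weight fails (φ need not be square integrable near λ=t), so membership is stated for s↦φ(t+s) in L²((0,∞); s ds); t>1 is assumed so that no singular point lies in (t,∞); (ii) assumes the pair's second equation dΦ/dt=−W_tΦ/(λ−t). *)

theory Defs
  imports "HOL-Analysis.Analysis"
begin

section \<open>Matrices\<close>

definition W_mat :: "real \<Rightarrow> real \<Rightarrow> real \<Rightarrow> real^2^2" where
  "W_mat \<theta> z u = vector [vector [z + \<theta> / 2, - u * z],
                         vector [inverse u * (z + \<theta>), - z - \<theta> / 2]]"

definition J_mat :: "real^2^2" where
  "J_mat = vector [vector [0, - 1], vector [1, 0]]"

text \<open>The block matrix \<open>diag(I\<^sub>j, - I\<^sub>k)\<close> acting on
  \<open>real^('j + 'k)\<close>, a copy of the Euclidean space of dimension \<open>CARD('j) + CARD('k)\<close> whose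
  index type displays the two blocks.\<close>

definition sigma_mat :: "real^('j::finite + 'k::finite)^('j + 'k)" where
  "sigma_mat = (\<chi> a b. if a = b then (case a of Inl _ \<Rightarrow> 1 | Inr _ \<Rightarrow> - 1) else 0)"

text \<open>Eigenvalues of a real matrix are taken in the complex numbers.\<close>

definition complex_eigenvalues :: "real^'n^'n \<Rightarrow> complex set" where
  "complex_eigenvalues A =
     {c. \<exists>v :: complex^'n. v \<noteq> 0 \<and> (\<chi> i j. complex_of_real (A $ i $ j)) *v v = c *s v}"


section \<open>Square integrable functions and trace class operators\<close>

text \<open>Elements of \<open>L2_space M\<close> are functions, not classes of functions modulo null sets;
  everything below depends only on the classes.\<close>

definition L2_space :: "'a measure \<Rightarrow> ('a \<Rightarrow> 'b::{real_normed_vector, second_countable_topology}) set" where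
  "L2_space M = {f \<in> borel_measurable M. integrable M (\<lambda>x. (norm (f x))\<^sup>2)}"

definition L2_inner :: "'a measure \<Rightarrow> ('a \<Rightarrow> real) \<Rightarrow> ('a \<Rightarrow> real) \<Rightarrow> real" where
  "L2_inner M f g = (\<integral>x. f x * g x \<partial>M)"

definition L2_norm :: "'a measure \<Rightarrow> ('a \<Rightarrow> real) \<Rightarrow> real" where
  "L2_norm M f = sqrt (\<integral>x. (f x)\<^sup>2 \<partial>M)"

text \<open>An operator on the Hilbert space \<open>L\<^sup>2(M)\<close> is trace class (nuclear) if it is a sum of rank-one
  operators \<open>f \<mapsto> \<langle>f, a\<^sub>n\<rangle> b\<^sub>n\<close> with \<open>\<Sum>\<^sub>n \<parallel>a\<^sub>n\<parallel> \<parallel>b\<^sub>n\<parallel> < \<infinity>\<close>; the series then converges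
  in trace norm, so it is enough to identify its sum pointwise on \<open>L\<^sup>2(M)\<close>.\<close>

definition trace_class_op :: "'a measure \<Rightarrow> (('a \<Rightarrow> real) \<Rightarrow> ('a \<Rightarrow> real)) \<Rightarrow> bool" where
  "trace_class_op M A \<longleftrightarrow>
     (\<forall>f\<in>L2_space M. A f \<in> L2_space M) \<and>
     (\<exists>a b :: nat \<Rightarrow> 'a \<Rightarrow> real.
        (\<forall>n. a n \<in> L2_space M \<and> b n \<in> L2_space M) \<and>
        summable (\<lambda>n. L2_norm M (a n) * L2_norm M (b n)) \<and>
        (\<forall>f\<in>L2_space M.
           (\<lambda>N. L2_norm M (\<lambda>x. A f x - (\<Sum>n<N. L2_inner M f (a n) * b n x))) \<longlonglongrightarrow> 0))"

text \<open>The Bochner integral of a non-integrable function is \<open>0\<close> by convention, so the integrability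
  required of an integral operator is stated separately.\<close>

definition trace_class_kernel :: "'a measure \<Rightarrow> ('a \<Rightarrow> 'a \<Rightarrow> real) \<Rightarrow> bool" where
  "trace_class_kernel M k \<longleftrightarrow>
     (\<forall>f\<in>L2_space M. AE x in M. integrable M (\<lambda>y. k x y * f y)) \<and>
     trace_class_op M (\<lambda>f x. \<integral>y. k x y * f y \<partial>M)"


section \<open>Kernels\<close>

text \<open>On the diagonal the quotient has the value \<open>0\<close> in HOL instead of the limit; the diagonal is a
  null set, and it is excluded from all pointwise statements about the kernel.\<close>

definition K_kernel :: "(real \<Rightarrow> real \<Rightarrow> real^2) \<Rightarrow> real \<Rightarrow> real \<Rightarrow> real \<Rightarrow> real" where
  "K_kernel \<Phi> x y t = ((J_mat *v \<Phi> x t) \<bullet> \<Phi> y t) / (x - y)"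

definition finite_rank_off_diagonal :: "'a set \<Rightarrow> ('a \<Rightarrow> 'a \<Rightarrow> real) \<Rightarrow> bool" where
  "finite_rank_off_diagonal S k \<longleftrightarrow>
     (\<exists>(n::nat) (f :: nat \<Rightarrow> 'a \<Rightarrow> real) (g :: nat \<Rightarrow> 'a \<Rightarrow> real).
        \<forall>x\<in>S. \<forall>y\<in>S. x \<noteq> y \<longrightarrow> k x y = (\<Sum>i<n. f i x * g i y))"

end

theory Submission
  imports Defs
begin

text \<open>
  The matrices \<open>W\<^sub>\<nu>\<close> are traceless with \<open>det W\<^sub>\<nu> = - \<theta>\<^sub>\<nu>\<^sup>2 / 4 \<le> 0\<close>. For a traceless \<open>A\<close> the matrix
  \<open>J A\<close> is symmetric, so differentiating \<open>\<langle>J \<Phi>(x), \<Phi>(y)\<rangle>\<close> along the diagonal direction brings out the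
  differences \<open>1/(x - \<nu>) - 1/(y - \<nu>)\<close>, each divisible by \<open>x - y\<close>:
  \<open>(\<partial>\<^sub>x + \<partial>\<^sub>y) K(x, y) = - \<Sum>\<^sub>\<nu> \<langle>J W\<^sub>\<nu> \<Phi>(x), \<Phi>(y)\<rangle> / ((x - \<nu>)(y - \<nu>))\<close>.
  As \<open>\<Phi>\<close> is bounded and \<open>\<Phi>' = O(1/x)\<close>, while \<open>\<langle>J v, v\<rangle> = 0\<close>, the kernel tends to \<open>0\<close> along the
  diagonal direction, and \<open>K(x, y)\<close> is the integral of the right-hand side, with the sign changed,
  over \<open>(x + s, y + s)\<close>, \<open>s > 0\<close> (\<open>kernel_integral\<close>).  Since \<open>det (J W\<^sub>\<nu>) \<le> 0\<close>, each form
  \<open>\<langle>J W\<^sub>\<nu> x, y\<rangle>\<close> is a difference of two squares of linear forms, moreover of linear forms in \<open>W\<^sub>\<nu> x\<close>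
  (\<open>traceless_signature\<close>); the three poles together give the signature \<open>(3,3)\<close>.

  The point that needs care is the weight \<open>s \<parallel>\<phi>(t + s)\<parallel>\<^sup>2\<close> at the pole \<open>t\<close>, where the \<open>L\<^sup>2\<close> hypothesis
  on \<open>\<Phi>\<close> says nothing: \<open>\<parallel>W\<^sub>t \<Phi>(t + s)\<parallel>\<^sup>2 / s\<close> must be integrable.  This follows
  from an energy identity.  By Cayley-Hamilton \<open>W\<^sub>t\<^sup>2 = (\<theta>\<^sub>t\<^sup>2 / 4) I\<close>, hence
  \<open>d/ds \<langle>W\<^sub>t \<Phi>, \<Phi>\<rangle> = (\<parallel>W\<^sub>t \<Phi>\<parallel>\<^sup>2 + \<theta>\<^sub>t\<^sup>2 \<parallel>\<Phi>\<parallel>\<^sup>2 / 4) / s + O(1)\<close>, and the left-hand side is the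
  derivative of a bounded function, so that \<open>\<parallel>W\<^sub>t \<Phi>\<parallel>\<^sup>2 / s\<close> is integrable near \<open>0\<close>
  (\<open>square_integrable_near_pole\<close>).  The degenerate case \<open>\<theta>\<^sub>t = 0\<close> is included, because only
  \<open>W\<^sub>t \<Phi>\<close>, and not \<open>\<Phi>\<close> itself, enters the factorisation.  At infinity the \<open>L\<^sup>2\<close> hypothesis suffices.

  Thus \<open>K = k\<^sub>1 - k\<^sub>2\<close> off the diagonal, where \<open>k\<^sub>i(x, y) = \<integral> \<langle>p\<^sub>i(x + s), p\<^sub>i(y + s)\<rangle> ds\<close> is the Gram
  kernel of the translates of \<open>p\<^sub>i\<close>.  Both are continuous and positive semidefinite, and
  \<open>\<integral> k\<^sub>i(x, x) dx = \<integral> s \<parallel>p\<^sub>i(t + s)\<parallel>\<^sup>2 ds\<close> is finite.  Such kernels are trace class: this is Mercer's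
  theorem, with elimination in place of eigenfunctions.  Cholesky elimination along a dense sequence of
  pivots writes the kernel as \<open>\<Sum>\<^sub>n a\<^sub>n(x) a\<^sub>n(y)\<close>; the residual is positive semidefinite, hence
  controlled by its diagonal, which decreases to \<open>0\<close> pointwise (\<open>residual_diag_tendsto_0\<close>), and
  dominated convergence turns this into convergence of the operators
  (\<open>trace_class_psd_difference\<close>).

  For the second claim, the same algebra applied to the \<open>t\<close>-equation gives
  \<open>\<partial>\<^sub>t K(x, y; t) = \<langle>J W\<^sub>t \<Phi>(x), \<Phi>(y)\<rangle> / ((x - t)(y - t))\<close>, of rank at most two.
\<close>

section \<open>Trace class integral operators\<close>

text \<open>The common core of the Cauchy-Schwarz inequalities below; \<open>C = 0\<close> is allowed, as it occurs for
  the residuals of an elimination.\<close>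
lemma nonneg_form_discriminant:
  fixes A B C :: real
  assumes q: "\<And>c d. 0 \<le> c\<^sup>2 * A + 2 * c * d * B + d\<^sup>2 * C"
  shows "B\<^sup>2 \<le> A * C"
proof (cases "C = 0")
  case True
  \<comment> \<open>for \<open>c = B\<close> this \<open>d\<close> gives the form the value \<open>- B\<^sup>2\<close>, whatever \<open>A\<close> is\<close>
  have "0 \<le> B\<^sup>2 * A + 2 * B * (- (A + 1) / 2) * B"
    using q[of B "- (A + 1) / 2"] True by simp
  also have "\<dots> = - B\<^sup>2" by (simp add: power2_eq_square field_simps)
  finally show ?thesis using True by simp
next
  case False
  have "C \<ge> 0" using q[of 0 1] by simp
  with False have "C > 0" by simp
  have "0 \<le> C\<^sup>2 * A + 2 * C * (- B) * B + (- B)\<^sup>2 * C" by (rule q)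
  also have "\<dots> = C * (A * C - B\<^sup>2)" by (simp add: power2_eq_square algebra_simps)
  finally show ?thesis using \<open>C > 0\<close> by (simp add: zero_le_mult_iff)
qed

lemma L2_prod_integrable:
  fixes f g :: "'a \<Rightarrow> real"
  assumes "f \<in> L2_space M" "g \<in> L2_space M"
  shows "integrable M (\<lambda>x. f x * g x)"
proof (rule Bochner_Integration.integrable_bound)
  show "integrable M (\<lambda>x. (norm (f x))\<^sup>2 + (norm (g x))\<^sup>2)"
    using assms by (auto simp: L2_space_def)
  show "(\<lambda>x. f x * g x) \<in> borel_measurable M"
    using assms by (auto simp: L2_space_def)
  have "\<bar>a * b\<bar> \<le> a\<^sup>2 + b\<^sup>2" for a b :: real
    using sum_squares_bound[of "\<bar>a\<bar>" "\<bar>b\<bar>"] abs_ge_zero[of "a * b"]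
    unfolding abs_mult power2_abs by linarith
  then show "AE x in M. norm (f x * g x) \<le> norm ((norm (f x))\<^sup>2 + (norm (g x))\<^sup>2)"
    by simp
qed

lemma L2_Cauchy_Schwarz:
  fixes f g :: "'a \<Rightarrow> real"
  assumes f: "f \<in> L2_space M" and g: "g \<in> L2_space M"
  shows "\<bar>\<integral>x. f x * g x \<partial>M\<bar> \<le> L2_norm M f * L2_norm M g"
proof -
  let ?A = "\<integral>x. (f x)\<^sup>2 \<partial>M" and ?B = "\<integral>x. f x * g x \<partial>M" and ?C = "\<integral>x. (g x)\<^sup>2 \<partial>M"
  have i: "integrable M (\<lambda>x. (f x)\<^sup>2)" "integrable M (\<lambda>x. (g x)\<^sup>2)" "integrable M (\<lambda>x. f x * g x)"
    using f g L2_prod_integrable[OF f g] by (auto simp: L2_space_def)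
  have q: "0 \<le> c\<^sup>2 * ?A + 2 * c * d * ?B + d\<^sup>2 * ?C" for c d
  proof -
    have "0 \<le> (\<integral>x. (c * f x + d * g x)\<^sup>2 \<partial>M)" by simp
    also have "(\<integral>x. (c * f x + d * g x)\<^sup>2 \<partial>M)
        = (\<integral>x. c\<^sup>2 * (f x)\<^sup>2 + (2 * c * d) * (f x * g x) + d\<^sup>2 * (g x)\<^sup>2 \<partial>M)"
      by (simp add: power2_eq_square algebra_simps)
    also have "\<dots> = c\<^sup>2 * ?A + (2 * c * d) * ?B + d\<^sup>2 * ?C"
      using i by simp
    finally show ?thesis .
  qed
  have "?B\<^sup>2 \<le> ?A * ?C" by (rule nonneg_form_discriminant[OF q])
  then have "sqrt (?B\<^sup>2) \<le> sqrt (?A * ?C)" by (rule real_sqrt_le_mono)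
  then show ?thesis by (simp add: L2_norm_def real_sqrt_mult)
qed

text \<open>A kernel whose \<open>N\<close>-th remainder is dominated by a product \<open>e\<^sub>N(x) e\<^sub>N(y)\<close> is approximated to within
  \<open>\<parallel>e\<^sub>N\<parallel>\<^sup>2\<close> in operator norm, by the Cauchy-Schwarz inequality in \<open>y\<close>.  The case \<open>N = 0\<close> supplies the
  integrability and the boundedness of the operator.  The estimate is asked for almost every \<open>y\<close> only,
  which leaves the kernel free on null sets such as the diagonal.\<close>
lemma trace_class_kernelI:
  fixes k :: "'a \<Rightarrow> 'a \<Rightarrow> real"
  assumes sf: "sigma_finite_measure M"
    and meas: "(\<lambda>(x, y). k x y) \<in> borel_measurable (M \<Otimes>\<^sub>M M)"
    and a: "\<And>n. a n \<in> L2_space M" and b: "\<And>n. b n \<in> L2_space M"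
    and nuclear: "summable (\<lambda>n. L2_norm M (a n) * L2_norm M (b n))"
    and e: "\<And>N. e N \<in> L2_space M"
    and bound: "\<And>N x. x \<in> space M \<Longrightarrow> AE y in M. \<bar>k x y - (\<Sum>n<N. a n y * b n x)\<bar> \<le> e N x * e N y"
    and lim: "(\<lambda>N. \<integral>x. (e N x)\<^sup>2 \<partial>M) \<longlonglongrightarrow> 0"
  shows "trace_class_kernel M k"
proof -
  interpret sigma_finite_measure M by fact
  have kx: "(\<lambda>y. k x y) \<in> borel_measurable M" if "x \<in> space M" for x
    using measurable_compose[OF measurable_Pair1'[OF that] meas] by simp
  have absL2: "(\<lambda>x. \<bar>f x\<bar>) \<in> L2_space M" if "f \<in> L2_space M" for f :: "'a \<Rightarrow> real"
    using that by (auto simp: L2_space_def)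
  have norm_abs: "L2_norm M (\<lambda>x. \<bar>f x\<bar>) = L2_norm M f" for f
    by (simp add: L2_norm_def)
  have fin: "integrable M (\<lambda>y. (\<Sum>n<N. a n y * b n x) * f y)"
    and fin_eq: "(\<integral>y. (\<Sum>n<N. a n y * b n x) * f y \<partial>M) = (\<Sum>n<N. L2_inner M f (a n) * b n x)"
    if f: "f \<in> L2_space M" for f N x
  proof -
    have *: "(\<Sum>n<N. a n y * b n x) * f y = (\<Sum>n<N. b n x * (f y * a n y))" for y
      unfolding sum_distrib_right by (rule sum.cong) (auto simp: mult_ac)
    have i: "integrable M (\<lambda>y. b n x * (f y * a n y))" for n
      using L2_prod_integrable[OF f a] by simp
    show "integrable M (\<lambda>y. (\<Sum>n<N. a n y * b n x) * f y)"
      unfolding * using i by (rule Bochner_Integration.integrable_sum)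
    show "(\<integral>y. (\<Sum>n<N. a n y * b n x) * f y \<partial>M) = (\<Sum>n<N. L2_inner M f (a n) * b n x)"
      unfolding * using i by (subst Bochner_Integration.integral_sum) (auto simp: L2_inner_def mult.commute)
  qed
  have rem: "integrable M (\<lambda>y. (k x y - (\<Sum>n<N. a n y * b n x)) * f y)"
    and rem_le: "\<bar>\<integral>y. (k x y - (\<Sum>n<N. a n y * b n x)) * f y \<partial>M\<bar>
                   \<le> \<bar>e N x\<bar> * (L2_norm M (e N) * L2_norm M f)"
    if f: "f \<in> L2_space M" and x: "x \<in> space M" for f N x
  proof -
    have [measurable]: "(\<lambda>y. k x y) \<in> borel_measurable M" "f \<in> borel_measurable M"
      "\<And>n. a n \<in> borel_measurable M"
      using kx[OF x] f a by (auto simp: L2_space_def)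
    have ei: "integrable M (\<lambda>y. \<bar>e N y\<bar> * \<bar>f y\<bar>)"
      by (intro L2_prod_integrable absL2 e f)
    then have dom: "integrable M (\<lambda>y. \<bar>e N x\<bar> * (\<bar>e N y\<bar> * \<bar>f y\<bar>))" by simp
    have le: "AE y in M. \<bar>(k x y - (\<Sum>n<N. a n y * b n x)) * f y\<bar> \<le> \<bar>e N x\<bar> * (\<bar>e N y\<bar> * \<bar>f y\<bar>)"
      using bound[OF x, of N]
    proof eventually_elim
      case (elim y)
      have "\<bar>k x y - (\<Sum>n<N. a n y * b n x)\<bar> * \<bar>f y\<bar> \<le> (e N x * e N y) * \<bar>f y\<bar>"
        using elim by (rule mult_right_mono) simp
      also have "\<dots> \<le> \<bar>e N x * e N y\<bar> * \<bar>f y\<bar>" by (rule mult_right_mono) auto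
      finally show ?case by (simp add: abs_mult mult_ac)
    qed
    show int: "integrable M (\<lambda>y. (k x y - (\<Sum>n<N. a n y * b n x)) * f y)"
      by (rule Bochner_Integration.integrable_bound[OF dom]) (use le in \<open>auto\<close>)
    have "\<bar>\<integral>y. (k x y - (\<Sum>n<N. a n y * b n x)) * f y \<partial>M\<bar>
        \<le> (\<integral>y. \<bar>(k x y - (\<Sum>n<N. a n y * b n x)) * f y\<bar> \<partial>M)"
      by (rule integral_abs_bound)
    also have "\<dots> \<le> (\<integral>y. \<bar>e N x\<bar> * (\<bar>e N y\<bar> * \<bar>f y\<bar>) \<partial>M)"
      using int dom le by (intro integral_mono_AE) auto
    also have "\<dots> = \<bar>e N x\<bar> * (\<integral>y. \<bar>e N y\<bar> * \<bar>f y\<bar> \<partial>M)" by simp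
    also have "\<dots> \<le> \<bar>e N x\<bar> * (L2_norm M (e N) * L2_norm M f)"
      using L2_Cauchy_Schwarz[OF absL2[OF e[of N]] absL2[OF f]]
      by (intro mult_left_mono) (auto simp: norm_abs)
    finally show "\<bar>\<integral>y. (k x y - (\<Sum>n<N. a n y * b n x)) * f y \<partial>M\<bar>
                   \<le> \<bar>e N x\<bar> * (L2_norm M (e N) * L2_norm M f)" .
  qed
  have int: "integrable M (\<lambda>y. k x y * f y)" if "f \<in> L2_space M" "x \<in> space M" for f x
    using rem[OF that, of 0] by simp
  have rem_eq: "(\<integral>y. (k x y - (\<Sum>n<N. a n y * b n x)) * f y \<partial>M)
       = (\<integral>y. k x y * f y \<partial>M) - (\<Sum>n<N. L2_inner M f (a n) * b n x)"
    if f: "f \<in> L2_space M" and x: "x \<in> space M" for f N x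
    unfolding left_diff_distrib
    by (subst Bochner_Integration.integral_diff[OF int[OF f x] fin[OF f]]) (simp add: fin_eq[OF f])
  have Af_meas: "(\<lambda>x. \<integral>y. k x y * f y \<partial>M) \<in> borel_measurable M" if f: "f \<in> L2_space M" for f
  proof -
    have [measurable]: "f \<in> borel_measurable M" using f by (auto simp: L2_space_def)
    have "(\<lambda>(x, y). k x y * f y) \<in> borel_measurable (M \<Otimes>\<^sub>M M)"
      using meas by (simp add: split_beta)
    then show ?thesis by (rule borel_measurable_lebesgue_integral)
  qed
  have e2: "integrable M (\<lambda>x. (\<bar>e N x\<bar> * c)\<^sup>2)" for N c
    using e[of N] by (auto simp: L2_space_def power_mult_distrib)
  have Af: "(\<lambda>x. \<integral>y. k x y * f y \<partial>M) \<in> L2_space M" if f: "f \<in> L2_space M" for f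
  proof -
    have [measurable]: "(\<lambda>x. \<integral>y. k x y * f y \<partial>M) \<in> borel_measurable M" by (rule Af_meas[OF f])
    have "integrable M (\<lambda>x. (norm (\<integral>y. k x y * f y \<partial>M))\<^sup>2)"
    proof (rule Bochner_Integration.integrable_bound[OF e2[of 0 "L2_norm M (e 0) * L2_norm M f"]])
      show "AE x in M. norm ((norm (\<integral>y. k x y * f y \<partial>M))\<^sup>2)
                \<le> norm ((\<bar>e 0 x\<bar> * (L2_norm M (e 0) * L2_norm M f))\<^sup>2)"
      proof (rule AE_I2)
        fix x assume x: "x \<in> space M"
        show "norm ((norm (\<integral>y. k x y * f y \<partial>M))\<^sup>2)
                \<le> norm ((\<bar>e 0 x\<bar> * (L2_norm M (e 0) * L2_norm M f))\<^sup>2)"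
          using power_mono[OF rem_le[OF f x, of 0], of 2] by simp
      qed
    qed measurable
    then show ?thesis by (simp add: L2_space_def Af_meas[OF f])
  qed
  have conv: "(\<lambda>N. L2_norm M (\<lambda>x. (\<integral>y. k x y * f y \<partial>M) - (\<Sum>n<N. L2_inner M f (a n) * b n x))) \<longlonglongrightarrow> 0"
    if f: "f \<in> L2_space M" for f
  proof (rule tendsto_sandwich)
    show "\<forall>\<^sub>F N in sequentially. 0 \<le> L2_norm M (\<lambda>x. (\<integral>y. k x y * f y \<partial>M) - (\<Sum>n<N. L2_inner M f (a n) * b n x))"
      by (simp add: L2_norm_def)
    show "(\<lambda>N. (\<integral>x. (e N x)\<^sup>2 \<partial>M) * L2_norm M f) \<longlonglongrightarrow> 0"
      using tendsto_mult_right[OF lim, of "L2_norm M f"] by simp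
    show "(\<lambda>N. 0::real) \<longlonglongrightarrow> 0" by simp
    show "\<forall>\<^sub>F N in sequentially. L2_norm M (\<lambda>x. (\<integral>y. k x y * f y \<partial>M) - (\<Sum>n<N. L2_inner M f (a n) * b n x))
        \<le> (\<integral>x. (e N x)\<^sup>2 \<partial>M) * L2_norm M f"
    proof (rule always_eventually, rule allI)
      fix N
      let ?R = "\<lambda>x. (\<integral>y. k x y * f y \<partial>M) - (\<Sum>n<N. L2_inner M f (a n) * b n x)"
      let ?c = "L2_norm M (e N) * L2_norm M f"
      have c: "?c \<ge> 0" by (simp add: L2_norm_def)
      have [measurable]: "(\<lambda>x. \<integral>y. k x y * f y \<partial>M) \<in> borel_measurable M" "\<And>n. b n \<in> borel_measurable M"
        using Af_meas[OF f] b by (auto simp: L2_space_def)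
      have le: "(?R x)\<^sup>2 \<le> (\<bar>e N x\<bar> * ?c)\<^sup>2" if x: "x \<in> space M" for x
        using rem_le[OF f x, of N] rem_eq[OF f x, of N] c by (intro power2_le_iff_abs_le[THEN iffD2]) auto
      have "(\<integral>x. (?R x)\<^sup>2 \<partial>M) \<le> (\<integral>x. (\<bar>e N x\<bar> * ?c)\<^sup>2 \<partial>M)"
      proof (rule integral_mono[OF _ e2 le])
        show "integrable M (\<lambda>x. (?R x)\<^sup>2)"
        proof (rule Bochner_Integration.integrable_bound[OF e2[of N ?c]])
          show "AE x in M. norm ((?R x)\<^sup>2) \<le> norm ((\<bar>e N x\<bar> * ?c)\<^sup>2)"
          proof (rule AE_I2)
            fix x assume "x \<in> space M"
            from le[OF this] show "norm ((?R x)\<^sup>2) \<le> norm ((\<bar>e N x\<bar> * ?c)\<^sup>2)" by simp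
          qed
        qed measurable
      qed
      also have "\<dots> = (L2_norm M (e N) * ?c)\<^sup>2"
        by (simp add: power_mult_distrib L2_norm_def)
      finally have "L2_norm M ?R \<le> sqrt ((L2_norm M (e N) * ?c)\<^sup>2)"
        unfolding L2_norm_def[of M ?R] by (rule real_sqrt_le_mono)
      also have "\<dots> = L2_norm M (e N) * ?c" using c by (simp add: L2_norm_def)
      also have "\<dots> = (\<integral>x. (e N x)\<^sup>2 \<partial>M) * L2_norm M f"
        by (simp add: L2_norm_def)
      finally show "L2_norm M ?R \<le> (\<integral>x. (e N x)\<^sup>2 \<partial>M) * L2_norm M f" .
    qed
  qed
  show ?thesis
    unfolding trace_class_kernel_def trace_class_op_def
  proof (intro conjI ballI)
    show "AE x in M. integrable M (\<lambda>y. k x y * f y)" if "f \<in> L2_space M" for f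
      by (rule AE_I2) (rule int[OF that])
  qed (fact Af, rule exI[of _ a], rule exI[of _ b], (intro conjI allI ballI; fact a b nuclear conv))
qed

section \<open>Positive semidefinite kernels and Cholesky elimination\<close>

text \<open>The points \<open>p i\<close> may repeat, so that a further point can be appended to a family without asking
  whether it is already present.\<close>
definition psd_kernel :: "'a set \<Rightarrow> ('a \<Rightarrow> 'a \<Rightarrow> real) \<Rightarrow> bool" where
  "psd_kernel S k \<longleftrightarrow> (\<forall>x\<in>S. \<forall>y\<in>S. k x y = k y x) \<and>
     (\<forall>(n::nat) c p. (\<forall>i<n. p i \<in> S) \<longrightarrow> 0 \<le> (\<Sum>i<n. \<Sum>j<n. c i * c j * k (p i) (p j)))"

lemma psd_kernel_sym: "psd_kernel S k \<Longrightarrow> x \<in> S \<Longrightarrow> y \<in> S \<Longrightarrow> k x y = k y x"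
  by (simp add: psd_kernel_def)

lemma psd_kernel_form:
  fixes n :: nat
  shows "psd_kernel S k \<Longrightarrow> (\<And>i. i < n \<Longrightarrow> p i \<in> S) \<Longrightarrow> 0 \<le> (\<Sum>i<n. \<Sum>j<n. c i * c j * k (p i) (p j))"
  unfolding psd_kernel_def by blast

lemma psd_kernel_two:
  assumes k: "psd_kernel S k" and x: "x \<in> S" and y: "y \<in> S"
  shows "0 \<le> c\<^sup>2 * k x x + 2 * c * d * k x y + d\<^sup>2 * k y y"
proof -
  have "0 \<le> (\<Sum>i<2::nat. \<Sum>j<2::nat. (if i = 0 then c else d) * (if j = 0 then c else d) *
               k (if i = 0 then x else y) (if j = (0::nat) then x else y))"
    by (rule psd_kernel_form[OF k]) (use x y in auto)
  also have "\<dots> = c\<^sup>2 * k x x + 2 * c * d * k x y + d\<^sup>2 * k y y"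
    using psd_kernel_sym[OF k x y] by (simp add: numeral_2_eq_2 power2_eq_square algebra_simps)
  finally show ?thesis .
qed

lemma psd_kernel_diag: "psd_kernel S k \<Longrightarrow> x \<in> S \<Longrightarrow> 0 \<le> k x x"
  using psd_kernel_two[of S k x x 1 0] by simp

lemma psd_kernel_Cauchy_Schwarz:
  assumes "psd_kernel S k" "x \<in> S" "y \<in> S"
  shows "(k x y)\<^sup>2 \<le> k x x * k y y"
  by (rule nonneg_form_discriminant[OF psd_kernel_two[OF assms]])

lemma psd_kernel_Cauchy_Schwarz_sqrt:
  assumes "psd_kernel S k" "x \<in> S" "y \<in> S"
  shows "\<bar>k x y\<bar> \<le> sqrt (k x x) * sqrt (k y y)"
  using real_sqrt_le_mono[OF psd_kernel_Cauchy_Schwarz[OF assms]] by (simp add: real_sqrt_mult)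

text \<open>Eliminating the point \<open>p\<close> amounts to minimising the quadratic form over the coefficient of \<open>p\<close>: the
  form of the complement at \<open>c\<close> is the form of \<open>k\<close> at \<open>c\<close> with \<open>p\<close> appended, for the optimal
  coefficient.  If \<open>k p p = 0\<close>, the division by zero leaves \<open>k\<close> unchanged, as it should: the row of
  \<open>p\<close> is then zero.\<close>
lemma psd_kernel_Schur_complement:
  assumes k: "psd_kernel S k" and p: "p \<in> S"
  shows "psd_kernel S (\<lambda>x y. k x y - k x p * k p y / k p p)"
  unfolding psd_kernel_def
proof (intro conjI ballI allI impI)
  fix x y assume "x \<in> S" "y \<in> S"
  then show "k x y - k x p * k p y / k p p = k y x - k y p * k p x / k p p"
    using psd_kernel_sym[OF k] p by (metis mult.commute)
next
  fix n :: nat and c and q assume q: "\<forall>i<n. q i \<in> S"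
  define B where "B = (\<Sum>i<n. c i * k (q i) p)"
  define Q where "Q = (\<Sum>i<n. \<Sum>j<n. c i * c j * k (q i) (q j))"
  have B': "(\<Sum>j<n. c j * k p (q j)) = B"
    unfolding B_def using q psd_kernel_sym[OF k p] by (intro sum.cong) auto
  have BB: "(\<Sum>i<n. \<Sum>j<n. c i * c j * (k (q i) p * k p (q j) / k p p)) = B * B / k p p"
  proof -
    have "(\<Sum>i<n. \<Sum>j<n. c i * c j * (k (q i) p * k p (q j) / k p p))
        = (\<Sum>i<n. \<Sum>j<n. (c i * k (q i) p) * (c j * k p (q j))) / k p p"
      by (simp add: sum_divide_distrib mult_ac)
    also have "\<dots> = B * B / k p p"
      by (simp add: sum_product[symmetric] B' B_def[symmetric])
    finally show ?thesis .
  qed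
  have eq: "(\<Sum>i<n. \<Sum>j<n. c i * c j * (k (q i) (q j) - k (q i) p * k p (q j) / k p p))
      = Q - B * B / k p p"
    unfolding Q_def BB[symmetric] by (simp add: sum_subtractf right_diff_distrib)
  show "0 \<le> (\<Sum>i<n. \<Sum>j<n. c i * c j * (k (q i) (q j) - k (q i) p * k p (q j) / k p p))"
  proof (cases "k p p = 0")
    case True
    then show ?thesis using psd_kernel_form[OF k, of n q c] q by (simp add: eq Q_def)
  next
    case False
    define l where "l = - B / k p p"
    define c' where "c' = c(n := l)"
    define q' where "q' = q(n := p)"
    have "0 \<le> (\<Sum>i<Suc n. \<Sum>j<Suc n. c' i * c' j * k (q' i) (q' j))"
      by (rule psd_kernel_form[OF k]) (use q p in \<open>auto simp: q'_def less_Suc_eq\<close>)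
    also have "\<dots> = Q + l * (\<Sum>i<n. c i * k (q i) p) + l * (\<Sum>j<n. c j * k p (q j)) + l * l * k p p"
      by (simp add: sum.distrib c'_def q'_def Q_def sum_distrib_left mult_ac)
    also have "\<dots> = Q + 2 * l * B + l * l * k p p"
      by (simp add: B' B_def[symmetric])
    also have "\<dots> = Q - B * B / k p p"
      using False by (simp add: l_def)
    finally show ?thesis by (simp add: eq)
  qed
qed

text \<open>What remains of \<open>k\<close> after Cholesky elimination with the pivots \<open>p 0, \<dots>, p (n - 1)\<close>.\<close>
primrec residual :: "(nat \<Rightarrow> 'a) \<Rightarrow> ('a \<Rightarrow> 'a \<Rightarrow> real) \<Rightarrow> nat \<Rightarrow> 'a \<Rightarrow> 'a \<Rightarrow> real" where
  "residual p k 0 = k"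
| "residual p k (Suc n) = (\<lambda>x y. residual p k n x y
     - residual p k n x (p n) * residual p k n (p n) y / residual p k n (p n) (p n))"

definition factor :: "(nat \<Rightarrow> 'a) \<Rightarrow> ('a \<Rightarrow> 'a \<Rightarrow> real) \<Rightarrow> nat \<Rightarrow> 'a \<Rightarrow> real" where
  "factor p k n x = residual p k n x (p n) / sqrt (residual p k n (p n) (p n))"

context
  fixes S :: "'a set" and k :: "'a \<Rightarrow> 'a \<Rightarrow> real" and p :: "nat \<Rightarrow> 'a"
  assumes k: "psd_kernel S k" and p: "\<And>n. p n \<in> S"
begin

lemma psd_kernel_residual: "psd_kernel S (residual p k n)"
  by (induction n) (use k psd_kernel_Schur_complement[OF _ p] in auto)

lemma residual_Suc_factor:
  assumes "x \<in> S" "y \<in> S"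
  shows "residual p k (Suc n) x y = residual p k n x y - factor p k n x * factor p k n y"
  using psd_kernel_diag[OF psd_kernel_residual p, of n n]
    psd_kernel_sym[OF psd_kernel_residual p assms(2), of n n]
  by (simp add: factor_def)

lemma residual_eq_diff:
  assumes "x \<in> S" "y \<in> S"
  shows "residual p k n x y = k x y - (\<Sum>i<n. factor p k i x * factor p k i y)"
  by (induction n) (simp, simp only: residual_Suc_factor[OF assms] sum.lessThan_Suc diff_diff_eq)

lemma residual_pivot_zero:
  assumes "m < n"
  shows "residual p k n (p m) (p m) = 0"
  using assms
proof (induction n)
  case (Suc n)
  show ?case
  proof (cases "m = n")
    case True
    then show ?thesis by simp
  next
    case False
    with Suc have "residual p k n (p m) (p m) = 0" by simp
    then have "residual p k (Suc n) (p m) (p m) \<le> 0"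
      by (simp only: residual_Suc_factor[OF p p]) simp
    then show ?thesis using psd_kernel_diag[OF psd_kernel_residual p, of "Suc n" m] by (simp only: order_antisym)
  qed
qed simp

text \<open>In terms of feature vectors, the residual diagonal at \<open>x\<close> is the squared distance of \<open>x\<close> from the
  span of the pivots, hence at most its squared distance from the pivot \<open>p m\<close>.  The proof stays with
  the kernel: the expression on the right decreases from one residual to the next, and for
  the \<open>n\<close>-th residual it reduces to the left-hand side.\<close>
lemma residual_le_pivot_distance:
  assumes x: "x \<in> S" and "m < n"
  shows "residual p k n x x \<le> k x x - 2 * k x (p m) + k (p m) (p m)"
proof -
  have zero: "residual p k n (p m) (p m) = 0" by (rule residual_pivot_zero[OF \<open>m < n\<close>])
  then have "residual p k n x (p m) = 0"
    using psd_kernel_Cauchy_Schwarz[OF psd_kernel_residual x p, of n m] by simp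
  then have "residual p k n x x = residual p k n x x - 2 * residual p k n x (p m) + residual p k n (p m) (p m)"
    by (simp add: zero)
  also have "\<dots> = k x x - 2 * k x (p m) + k (p m) (p m) - (\<Sum>i<n. (factor p k i x - factor p k i (p m))\<^sup>2)"
    by (simp add: residual_eq_diff x p power2_eq_square algebra_simps sum.distrib sum_subtractf sum_distrib_left)
  also have "\<dots> \<le> k x x - 2 * k x (p m) + k (p m) (p m)"
    by (simp add: sum_nonneg)
  finally show ?thesis .
qed

lemma residual_diag_bounds:
  assumes "x \<in> S"
  shows "0 \<le> residual p k n x x" "residual p k n x x \<le> k x x"
  using psd_kernel_diag[OF psd_kernel_residual assms, of n]
  by (auto simp: residual_eq_diff assms intro: sum_nonneg)

end

lemma continuous_on_kernel_compose:
  assumes "continuous_on (S \<times> S) (\<lambda>(x, y). k x y)"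
    and "continuous_on T f" "continuous_on T g" "f ` T \<subseteq> S" "g ` T \<subseteq> S"
  shows "continuous_on T (\<lambda>z. k (f z) (g z))"
  using continuous_on_compose2[OF assms(1) continuous_on_Pair[OF assms(2,3)]] assms(4,5) by auto

lemma residual_diag_tendsto_0:
  fixes S :: "'a::metric_space set"
  assumes k: "psd_kernel S k" and cont: "continuous_on (S \<times> S) (\<lambda>(x, y). k x y)"
    and p: "\<And>n. p n \<in> S" and dense: "S \<subseteq> closure (range p)" and x: "x \<in> S"
  shows "(\<lambda>n. residual p k n x x) \<longlonglongrightarrow> 0"
proof (rule LIMSEQ_I)
  fix r :: real assume r: "r > 0"
  define h where "h y = k x x - 2 * k x y + k y y" for y
  have "continuous_on S (\<lambda>y. k x y)"
    using x by (intro continuous_on_kernel_compose[OF cont] continuous_intros) auto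
  moreover have "continuous_on S (\<lambda>y. k y y)"
    using x by (intro continuous_on_kernel_compose[OF cont] continuous_intros) auto
  ultimately have "continuous_on S h"
    unfolding h_def by (intro continuous_intros)
  then obtain d where d: "d > 0" "\<And>y. y \<in> S \<Longrightarrow> dist y x < d \<Longrightarrow> dist (h y) (h x) < r"
    using x r unfolding continuous_on_iff by metis
  obtain m where m: "dist (p m) x < d"
    using subsetD[OF dense x] d(1) by (auto simp: closure_approachable)
  have "h x = 0" by (simp add: h_def)
  with d(2)[OF p m] have "h (p m) < r" by (simp add: dist_real_def)
  show "\<exists>n0. \<forall>n\<ge>n0. norm (residual p k n x x - 0) < r"
  proof (intro exI allI impI)
    fix n assume "n \<ge> Suc m"
    then have "residual p k n x x \<le> h (p m)"
      unfolding h_def by (intro residual_le_pivot_distance[OF k p x]) simp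
    with \<open>h (p m) < r\<close> residual_diag_bounds(1)[where p = p and n = n, OF k p x]
    show "norm (residual p k n x x - 0) < r" by simp
  qed
qed

lemma continuous_on_residual:
  assumes cont: "continuous_on (S \<times> S) (\<lambda>(x, y). k x y)" and p: "\<And>n. p n \<in> S"
  shows "continuous_on (S \<times> S) (\<lambda>(x, y). residual p k n x y)"
proof (induction n)
  case 0
  then show ?case using cont by simp
next
  case (Suc n)
  have "continuous_on (S \<times> S) (\<lambda>z. residual p k n (fst z) (p n))"
    using p by (intro continuous_on_kernel_compose[OF Suc] continuous_intros) auto
  moreover have "continuous_on (S \<times> S) (\<lambda>z. residual p k n (p n) (snd z))"
    using p by (intro continuous_on_kernel_compose[OF Suc] continuous_intros) auto
  ultimately show ?case
    using Suc by (cases "residual p k n (p n) (p n) = 0")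
      (auto simp: split_beta intro!: continuous_intros)
qed

lemma sqrt_Cauchy_Schwarz:
  fixes a b c d :: real
  assumes "0 \<le> a" "0 \<le> b" "0 \<le> c" "0 \<le> d"
  shows "sqrt a * sqrt b + sqrt c * sqrt d \<le> sqrt (a + c) * sqrt (b + d)"
proof (rule power2_le_imp_le)
  have "(sqrt (a + c) * sqrt (b + d))\<^sup>2 - (sqrt a * sqrt b + sqrt c * sqrt d)\<^sup>2
      = (sqrt a * sqrt d - sqrt c * sqrt b)\<^sup>2"
    using assms by (simp add: power2_sum power2_diff power_mult_distrib algebra_simps)
  moreover have "0 \<le> (sqrt a * sqrt d - sqrt c * sqrt b)\<^sup>2" by simp
  ultimately show "(sqrt a * sqrt b + sqrt c * sqrt d)\<^sup>2 \<le> (sqrt (a + c) * sqrt (b + d))\<^sup>2"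
    by linarith
qed (use assms in simp)

text \<open>Two sequences of rank-one terms are merged into one, the even positions for the first.\<close>
lemma sum_interleave:
  fixes f g :: "nat \<Rightarrow> 'b::comm_monoid_add"
  shows "(\<Sum>i<N. if even i then f (i div 2) else g (i div 2))
       = (\<Sum>i<(N + 1) div 2. f i) + (\<Sum>i<N div 2. g i)"
proof (induction N)
  case (Suc N)
  then show ?case by (cases "even N") (auto elim!: evenE oddE simp: ac_simps)
qed simp

text \<open>A form of Mercer's theorem.  The Cholesky factors of the two kernels are interleaved.  Summability
  of \<open>\<parallel>a\<^sub>n\<parallel>\<^sup>2\<close> holds because \<open>\<Sum>\<^sub>n a\<^sub>n(x)\<^sup>2\<close> never exceeds the diagonal, and the remainder is bounded through
  the diagonal of the residuals by two applications of the Cauchy-Schwarz inequality: one for each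
  kernel, and one to join them.\<close>
theorem trace_class_psd_difference:
  fixes S :: "'a::euclidean_space set"
  defines "M \<equiv> restrict_space lborel S"
  assumes S: "S \<in> sets borel" "S \<noteq> {}"
    and psd: "psd_kernel S k1" "psd_kernel S k2"
    and cont: "continuous_on (S \<times> S) (\<lambda>(x, y). k1 x y)" "continuous_on (S \<times> S) (\<lambda>(x, y). k2 x y)"
    and diag: "integrable M (\<lambda>x. k1 x x)" "integrable M (\<lambda>x. k2 x x)"
    and meas: "(\<lambda>(x, y). k x y) \<in> borel_measurable (M \<Otimes>\<^sub>M M)"
    and k: "\<And>x y. x \<in> S \<Longrightarrow> y \<in> S \<Longrightarrow> x \<noteq> y \<Longrightarrow> k x y = k1 x y - k2 x y"
  shows "trace_class_kernel M k"
proof -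
  have spM: "space M = S" by (simp add: M_def space_restrict_space)
  obtain D where D: "countable D" "D \<subseteq> S" "S \<subseteq> closure D" using separable[of S] by metis
  with S(2) have "D \<noteq> {}" by auto
  define p where "p = from_nat_into D"
  have rp: "range p = D" unfolding p_def using \<open>D \<noteq> {}\<close> D(1) by (rule range_from_nat_into)
  have p: "p n \<in> S" for n using rp D(2) by auto
  have dense: "S \<subseteq> closure (range p)" using rp D by simp
  have [measurable_cong]: "sets M = sets (restrict_space borel S)"
    unfolding M_def by (intro sets_restrict_space_cong sets_lborel)
  have contM: "g \<in> borel_measurable M" if "continuous_on S g" for g :: "'a \<Rightarrow> real"
    using borel_measurable_continuous_on_restrict[OF that]
    by (simp add: measurable_cong_sets[OF \<open>sets M = sets (restrict_space borel S)\<close> refl])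
  have diagM: "(\<lambda>x. residual p k' n x x) \<in> borel_measurable M"
    and factorM: "factor p k' n \<in> borel_measurable M"
    if "continuous_on (S \<times> S) (\<lambda>(x, y). k' x y)" for k' n
  proof -
    note c = continuous_on_kernel_compose[OF continuous_on_residual[OF that p], of S]
    have "continuous_on S (\<lambda>x. residual p k' n x x)"
      by (intro c continuous_intros) auto
    then show "(\<lambda>x. residual p k' n x x) \<in> borel_measurable M" by (rule contM)
    have "continuous_on S (\<lambda>x. residual p k' n x (p n))"
      using p by (intro c continuous_intros) auto
    from contM[OF this] show "factor p k' n \<in> borel_measurable M"
      unfolding factor_def by measurable
  qed
  have half: "filterlim (\<lambda>N::nat. N div 2) at_top sequentially"
    "filterlim (\<lambda>N::nat. (N + 1) div 2) at_top sequentially"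
  proof -
    have "Z \<le> n div 2" "Z \<le> (n + 1) div 2" if "2 * Z \<le> n" for Z n :: nat
      using that by auto
    then show "filterlim (\<lambda>N::nat. N div 2) at_top sequentially"
      "filterlim (\<lambda>N::nat. (N + 1) div 2) at_top sequentially"
      unfolding filterlim_at_top eventually_sequentially by blast+
  qed
  define a where "a n = (if even n then factor p k1 (n div 2) else factor p k2 (n div 2))" for n :: nat
  define b where "b n x = (if even n then a n x else - a n x)" for n :: nat and x
  define R where "R N x y = residual p k1 ((N + 1) div 2) x y" for N :: nat and x y
  define Q where "Q N x y = residual p k2 (N div 2) x y" for N :: nat and x y
  define e where "e N x = sqrt (R N x x + Q N x x)" for N x
  have diag_bounds: "0 \<le> R N x x" "R N x x \<le> k1 x x" "0 \<le> Q N x x" "Q N x x \<le> k2 x x"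
    if "x \<in> S" for N x
    using residual_diag_bounds[OF psd(1) p that] residual_diag_bounds[OF psd(2) p that]
    by (auto simp: R_def Q_def)
  have R_eq: "R N x y = k1 x y - (\<Sum>i<(N + 1) div 2. factor p k1 i x * factor p k1 i y)"
    and Q_eq: "Q N x y = k2 x y - (\<Sum>i<N div 2. factor p k2 i x * factor p k2 i y)"
    if "x \<in> S" "y \<in> S" for N x y
    unfolding R_def Q_def using residual_eq_diff[OF psd(1) p that] residual_eq_diff[OF psd(2) p that]
    by auto
  have aM [measurable]: "a n \<in> borel_measurable M" for n
    using factorM[OF cont(1)] factorM[OF cont(2)] by (simp add: a_def)
  have bM [measurable]: "b n \<in> borel_measurable M" for n
    unfolding b_def by measurable
  have eM [measurable]: "e N \<in> borel_measurable M" for N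
    using diagM[OF cont(1)] diagM[OF cont(2)] unfolding e_def R_def Q_def by measurable
  have b2: "(b n x)\<^sup>2 = (a n x)\<^sup>2" for n x by (simp add: b_def)
  have i12: "integrable M (\<lambda>x. k1 x x + k2 x x)" using diag by simp
  have sum_a2: "(\<Sum>n<N. (a n x)\<^sup>2) \<le> k1 x x + k2 x x" if x: "x \<in> S" for x N
  proof -
    have "(\<Sum>n<N. (a n x)\<^sup>2) = (\<Sum>n<N. if even n then (factor p k1 (n div 2) x)\<^sup>2 else (factor p k2 (n div 2) x)\<^sup>2)"
      by (intro sum.cong) (auto simp: a_def)
    also have "\<dots> = (\<Sum>i<(N + 1) div 2. (factor p k1 i x)\<^sup>2) + (\<Sum>i<N div 2. (factor p k2 i x)\<^sup>2)"
      by (rule sum_interleave)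
    also have "\<dots> = k1 x x - R N x x + (k2 x x - Q N x x)"
      using x by (simp add: R_eq Q_eq power2_eq_square)
    also have "\<dots> \<le> k1 x x + k2 x x" using diag_bounds[OF x, of N] by simp
    finally show ?thesis .
  qed
  have a2: "(a n x)\<^sup>2 \<le> k1 x x + k2 x x" if x: "x \<in> S" for x n
  proof -
    have "(a n x)\<^sup>2 \<le> (\<Sum>n<Suc n. (a n x)\<^sup>2)"
      by (simp add: sum_nonneg)
    also have "\<dots> \<le> k1 x x + k2 x x" by (rule sum_a2[OF x])
    finally show ?thesis .
  qed
  have a2i: "integrable M (\<lambda>x. (a n x)\<^sup>2)" for n
  proof (rule Bochner_Integration.integrable_bound[OF i12])
    show "AE x in M. norm ((a n x)\<^sup>2) \<le> norm (k1 x x + k2 x x)"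
      by (auto simp: spM intro!: AE_I2 order_trans[OF a2 abs_ge_self])
  qed measurable
  have e2: "(e N x)\<^sup>2 = R N x x + Q N x x" if "x \<in> S" for N x
    using diag_bounds[OF that, of N] by (simp add: e_def)
  have e2i: "integrable M (\<lambda>x. (e N x)\<^sup>2)" for N
  proof (rule Bochner_Integration.integrable_bound[OF i12])
    show "AE x in M. norm ((e N x)\<^sup>2) \<le> norm (k1 x x + k2 x x)"
    proof (rule AE_I2)
      fix x assume "x \<in> space M"
      then show "norm ((e N x)\<^sup>2) \<le> norm (k1 x x + k2 x x)"
        using diag_bounds[of x N] e2[of x N] by (simp add: spM)
    qed
  qed measurable
  show ?thesis
  proof (rule trace_class_kernelI[of M k a b e])
    show "sigma_finite_measure M"
      unfolding M_def using S by (intro sigma_finite_measure_restrict_space sigma_finite_lborel) auto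
    show "(\<lambda>(x, y). k x y) \<in> borel_measurable (M \<Otimes>\<^sub>M M)" by (rule meas)
    show "a n \<in> L2_space M" "b n \<in> L2_space M" for n
      using a2i by (auto simp: L2_space_def b2)
    show "e N \<in> L2_space M" for N
      using e2i by (auto simp: L2_space_def)
    show "summable (\<lambda>n. L2_norm M (a n) * L2_norm M (b n))"
    proof (rule summableI_nonneg_bounded)
      fix N
      show "0 \<le> L2_norm M (a N) * L2_norm M (b N)" by (simp add: L2_norm_def)
      have "(\<Sum>n<N. L2_norm M (a n) * L2_norm M (b n)) = (\<Sum>n<N. \<integral>x. (a n x)\<^sup>2 \<partial>M)"
        by (simp add: L2_norm_def b2)
      also have "\<dots> = (\<integral>x. (\<Sum>n<N. (a n x)\<^sup>2) \<partial>M)" using a2i by simp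
      also have "\<dots> \<le> (\<integral>x. k1 x x + k2 x x \<partial>M)"
        using a2i i12 sum_a2 by (intro integral_mono) (auto simp: spM)
      finally show "(\<Sum>n<N. L2_norm M (a n) * L2_norm M (b n)) \<le> (\<integral>x. k1 x x + k2 x x \<partial>M)" .
    qed
    show "AE y in M. \<bar>k x y - (\<Sum>n<N. a n y * b n x)\<bar> \<le> e N x * e N y" if "x \<in> space M" for N x
    proof -
      have x: "x \<in> S" using that spM by simp
      have "AE y in M. y \<noteq> x"
        unfolding M_def using S AE_lborel_singleton[of x] by (subst AE_restrict_space_iff) auto
      then show ?thesis
      proof (rule AE_mp[OF _ AE_I2], intro impI)
        fix y assume "y \<in> space M" and neq: "y \<noteq> x"
        then have y: "y \<in> S" using spM by simp
        have "(\<Sum>n<N. a n y * b n x) = (\<Sum>n<N. if even n then factor p k1 (n div 2) x * factor p k1 (n div 2) y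
             else - (factor p k2 (n div 2) x * factor p k2 (n div 2) y))"
          by (intro sum.cong) (auto simp: a_def b_def)
        also have "\<dots> = (k1 x y - R N x y) - (k2 x y - Q N x y)"
          unfolding sum_interleave[of "\<lambda>i. factor p k1 i x * factor p k1 i y"
              "\<lambda>i. - (factor p k2 i x * factor p k2 i y)"] R_eq[OF x y] Q_eq[OF x y] by (simp add: sum_negf)
        finally have "k x y - (\<Sum>n<N. a n y * b n x) = R N x y - Q N x y"
          using k[OF x y] neq by simp
        also have "\<bar>\<dots>\<bar> \<le> \<bar>R N x y\<bar> + \<bar>Q N x y\<bar>" by simp
        also have "\<dots> \<le> sqrt (R N x x) * sqrt (R N y y) + sqrt (Q N x x) * sqrt (Q N y y)"
          unfolding R_def Q_def
          by (intro add_mono psd_kernel_Cauchy_Schwarz_sqrt[OF psd_kernel_residual[OF psd(1) p] x y]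
              psd_kernel_Cauchy_Schwarz_sqrt[OF psd_kernel_residual[OF psd(2) p] x y])
        also have "\<dots> \<le> e N x * e N y"
          unfolding e_def by (intro sqrt_Cauchy_Schwarz diag_bounds x y)
        finally show "\<bar>k x y - (\<Sum>n<N. a n y * b n x)\<bar> \<le> e N x * e N y" .
      qed
    qed
    have "(\<lambda>N. \<integral>x. (e N x)\<^sup>2 \<partial>M) \<longlonglongrightarrow> (\<integral>x. 0 \<partial>M)"
    proof (rule integral_dominated_convergence[OF _ _ i12])
      show "AE x in M. (\<lambda>N. (e N x)\<^sup>2) \<longlonglongrightarrow> 0"
      proof (rule AE_I2)
        fix x assume "x \<in> space M"
        then have x: "x \<in> S" using spM by simp
        have "(\<lambda>N. R N x x + Q N x x) \<longlonglongrightarrow> 0 + 0"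
          unfolding R_def Q_def
          by (intro tendsto_add filterlim_compose[OF _ half(1)] filterlim_compose[OF _ half(2)]
              residual_diag_tendsto_0[OF psd(1) cont(1) p dense x]
              residual_diag_tendsto_0[OF psd(2) cont(2) p dense x])
        then show "(\<lambda>N. (e N x)\<^sup>2) \<longlonglongrightarrow> 0" by (simp add: e2[OF x])
      qed
      show "AE x in M. norm ((e N x)\<^sup>2) \<le> k1 x x + k2 x x" for N
      proof (rule AE_I2)
        fix x assume "x \<in> space M"
        then show "norm ((e N x)\<^sup>2) \<le> k1 x x + k2 x x"
          using diag_bounds[of x N] e2[of x N] by (simp add: spM)
      qed
    qed measurable
    then show "(\<lambda>N. \<integral>x. (e N x)\<^sup>2 \<partial>M) \<longlonglongrightarrow> 0" by simp
  qed
qed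

section \<open>Gram kernels of translates on a half line\<close>

abbreviation ray :: "real \<Rightarrow> real measure" where
  "ray a \<equiv> restrict_space lborel {a<..}"

lemma integrable_ray_iff: "integrable (ray a) f \<longleftrightarrow> set_integrable lborel {a<..} f"
  for f :: "real \<Rightarrow> 'b::{banach, second_countable_topology}"
  by (simp add: set_integrable_def integrable_restrict_space)

lemma measurable_ray_continuous:
  fixes f :: "real \<Rightarrow> 'b::topological_space"
  assumes "continuous_on {a<..} f"
  shows "f \<in> borel_measurable (ray a)"
proof -
  have "sets (ray a) = sets (restrict_space borel {a<..})"
    by (intro sets_restrict_space_cong sets_lborel)
  then show ?thesis
    using borel_measurable_continuous_on_restrict[OF assms] by (simp cong: measurable_cong_sets)
qed

text \<open>The integrable majorant for all integrals of products of two translates.\<close>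
lemma integrable_ray_shift_inverse_square:
  assumes m: "m > 0"
  shows "integrable (ray 0) (\<lambda>s. C / (m + s)\<^sup>2)"
proof -
  have "set_integrable lborel (einterval (ereal 0) \<infinity>) (\<lambda>s. 1 / (m + s)\<^sup>2)"
  proof (rule interval_integral_FTC_nonneg)
    show "DERIV (\<lambda>s. - 1 / (m + s)) x :> 1 / (m + x)\<^sup>2" if "ereal 0 < ereal x" for x
      using that m by (auto intro!: derivative_eq_intros simp: power2_eq_square)
    show "isCont (\<lambda>s. 1 / (m + s)\<^sup>2) x" if "ereal 0 < ereal x" for x
      using that m by (auto intro!: continuous_intros)
    have "((\<lambda>s. - 1 / (m + s)) \<longlongrightarrow> - 1 / (m + 0)) (at_right 0)"
      using m by (intro tendsto_intros) auto
    then show "(((\<lambda>s. - 1 / (m + s)) \<circ> real_of_ereal) \<longlongrightarrow> - 1 / m) (at_right (ereal 0))"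
      by (subst ereal_tendsto_simps1(2)) simp
    have "((\<lambda>s. - 1 / (m + s)) \<longlongrightarrow> 0) at_top"
      by (intro tendsto_divide_0[OF tendsto_const] filterlim_at_top_imp_at_infinity
          filterlim_tendsto_add_at_top[OF tendsto_const] filterlim_ident)
    then show "(((\<lambda>s. - 1 / (m + s)) \<circ> real_of_ereal) \<longlongrightarrow> 0) (at_left \<infinity>)"
      by (simp add: ereal_tendsto_simps)
  qed auto
  then have "integrable (ray 0) (\<lambda>s. C * (1 / (m + s)\<^sup>2))"
    by (intro integrable_mult_right) (simp add: integrable_ray_iff del: zero_ereal_def)
  then show ?thesis by simp
qed

definition gram :: "(real \<Rightarrow> 'b::euclidean_space) \<Rightarrow> real \<Rightarrow> real \<Rightarrow> real" where
  "gram p x y = (\<integral>s. p (x + s) \<bullet> p (y + s) \<partial>ray 0)"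

context
  fixes p :: "real \<Rightarrow> 'b::euclidean_space" and t C :: real
  assumes cont: "continuous_on {t<..} p"
    and bound: "\<And>x. x > t \<Longrightarrow> norm (p x) \<le> C / (x - t)"
begin

lemma shift_measurable:
  assumes "x \<ge> t"
  shows "(\<lambda>s. p (x + s)) \<in> borel_measurable (ray 0)"
  by (intro measurable_ray_continuous continuous_on_compose2[OF cont] continuous_intros)
    (use assms in auto)

lemma gram_integrand_le:
  assumes m: "m > 0" and "x \<ge> t + m" "y \<ge> t + m" and s: "s > 0"
  shows "\<bar>p (x + s) \<bullet> p (y + s)\<bar> \<le> C\<^sup>2 / (m + s)\<^sup>2"
proof -
  have C: "C \<ge> 0" using order_trans[OF norm_ge_zero bound[of "t + 1"]] by simp
  have *: "norm (p (z + s)) \<le> C / (m + s)" if "z \<ge> t + m" for z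
  proof -
    have "norm (p (z + s)) \<le> C / (z + s - t)" using that m s by (intro bound) auto
    also have "\<dots> \<le> C / (m + s)" using that m s C by (intro divide_left_mono) auto
    finally show ?thesis .
  qed
  have "\<bar>p (x + s) \<bullet> p (y + s)\<bar> \<le> norm (p (x + s)) * norm (p (y + s))"
    by (rule Cauchy_Schwarz_ineq2)
  also have "\<dots> \<le> C / (m + s) * (C / (m + s))"
    using assms C by (intro mult_mono *) auto
  finally show ?thesis by (simp add: power2_eq_square)
qed

lemma gram_integrable:
  assumes "x > t" "y > t"
  shows "integrable (ray 0) (\<lambda>s. p (x + s) \<bullet> p (y + s))"
proof -
  define m where "m = min x y - t"
  have m: "m > 0" "x \<ge> t + m" "y \<ge> t + m" using assms by (auto simp: m_def)
  show ?thesis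
  proof (rule Bochner_Integration.integrable_bound[OF integrable_ray_shift_inverse_square[OF m(1), of "C\<^sup>2"]])
    show "(\<lambda>s. p (x + s) \<bullet> p (y + s)) \<in> borel_measurable (ray 0)"
      using assms by (intro borel_measurable_inner shift_measurable) auto
    show "AE s in ray 0. norm (p (x + s) \<bullet> p (y + s)) \<le> norm (C\<^sup>2 / (m + s)\<^sup>2)"
      using gram_integrand_le[OF m] by (intro AE_I2) (auto simp: space_restrict_space)
  qed
qed

lemma psd_kernel_gram: "psd_kernel {t<..} (gram p)"
  unfolding psd_kernel_def
proof (intro conjI ballI allI impI)
  fix x y show "gram p x y = gram p y x" by (simp add: gram_def inner_commute)
next
  fix n :: nat and c x assume x: "\<forall>i<n. x i \<in> {t<..}"
  have "0 \<le> (\<integral>s. (\<Sum>i<n. c i *\<^sub>R p (x i + s)) \<bullet> (\<Sum>j<n. c j *\<^sub>R p (x j + s)) \<partial>ray 0)"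
    by (rule Bochner_Integration.integral_nonneg) simp
  also have "\<dots> = (\<integral>s. (\<Sum>i<n. \<Sum>j<n. c i * c j * (p (x i + s) \<bullet> p (x j + s))) \<partial>ray 0)"
    by (simp only: inner_sum_left) (simp add: inner_sum_right sum_distrib_left mult_ac)
  also have "\<dots> = (\<Sum>i<n. \<Sum>j<n. c i * c j * gram p (x i) (x j))"
  proof -
    have i: "integrable (ray 0) (\<lambda>s. c i * c j * (p (x i + s) \<bullet> p (x j + s)))" if "i < n" "j < n" for i j
      using x that by (intro integrable_mult_right gram_integrable) auto
    have "(\<integral>s. (\<Sum>i<n. \<Sum>j<n. c i * c j * (p (x i + s) \<bullet> p (x j + s))) \<partial>ray 0)
        = (\<Sum>i<n. \<integral>s. (\<Sum>j<n. c i * c j * (p (x i + s) \<bullet> p (x j + s))) \<partial>ray 0)"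
      by (intro Bochner_Integration.integral_sum Bochner_Integration.integrable_sum i) auto
    also have "\<dots> = (\<Sum>i<n. \<Sum>j<n. \<integral>s. c i * c j * (p (x i + s) \<bullet> p (x j + s)) \<partial>ray 0)"
      by (intro sum.cong refl Bochner_Integration.integral_sum i) auto
    finally show ?thesis by (simp add: gram_def)
  qed
  finally show "0 \<le> (\<Sum>i<n. \<Sum>j<n. c i * c j * gram p (x i) (x j))" .
qed

lemma continuous_on_gram: "continuous_on ({t<..} \<times> {t<..}) (\<lambda>(x, y). gram p x y)"
proof (rule continuous_on_sequentiallyI)
  fix u :: "nat \<Rightarrow> real \<times> real" and z
  assume u: "\<forall>n. u n \<in> {t<..} \<times> {t<..}" and z: "z \<in> {t<..} \<times> {t<..}" and lim: "u \<longlonglongrightarrow> z"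
  \<comment> \<open>a common distance from \<open>t\<close>, so that one majorant serves a whole tail of the sequence\<close>
  define m where "m = (min (fst z) (snd z) - t) / 2"
  have m: "m > 0" "fst z > t + m" "snd z > t + m" using z by (auto simp: m_def min_def field_simps)
  have lim1: "(\<lambda>n. fst (u n)) \<longlonglongrightarrow> fst z" and lim2: "(\<lambda>n. snd (u n)) \<longlonglongrightarrow> snd z"
    using lim by (auto intro: tendsto_intros)
  have "\<forall>\<^sub>F n in sequentially. fst (u n) > t + m \<and> snd (u n) > t + m"
    using order_tendstoD(1)[OF lim1 m(2)] order_tendstoD(1)[OF lim2 m(3)] by (rule eventually_conj)
  then obtain N where N: "\<And>n. n \<ge> N \<Longrightarrow> fst (u n) > t + m \<and> snd (u n) > t + m"
    unfolding eventually_sequentially by blast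
  have "(\<lambda>n. gram p (fst (u (n + N))) (snd (u (n + N)))) \<longlonglongrightarrow> gram p (fst z) (snd z)"
    unfolding gram_def
  proof (rule integral_dominated_convergence[OF _ _ integrable_ray_shift_inverse_square[OF m(1), of "C\<^sup>2"]])
    show "(\<lambda>s. p (fst z + s) \<bullet> p (snd z + s)) \<in> borel_measurable (ray 0)"
      using z by (intro borel_measurable_inner shift_measurable) auto
    show "(\<lambda>s. p (fst (u (n + N)) + s) \<bullet> p (snd (u (n + N)) + s)) \<in> borel_measurable (ray 0)" for n
      using N[of "n + N"] m by (intro borel_measurable_inner shift_measurable) auto
    show "AE s in ray 0. norm (p (fst (u (n + N)) + s) \<bullet> p (snd (u (n + N)) + s)) \<le> C\<^sup>2 / (m + s)\<^sup>2" for n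
      using N[of "n + N"] gram_integrand_le[OF m(1)] by (intro AE_I2) (auto simp: space_restrict_space)
    show "AE s in ray 0. (\<lambda>n. p (fst (u (n + N)) + s) \<bullet> p (snd (u (n + N)) + s))
             \<longlonglongrightarrow> p (fst z + s) \<bullet> p (snd z + s)"
    proof (rule AE_I2)
      fix s assume "s \<in> space (ray 0)"
      then have s: "s > 0" by (simp add: space_restrict_space)
      have c: "isCont p x" if "x > t" for x
        using cont that by (simp add: continuous_on_eq_continuous_at)
      show "(\<lambda>n. p (fst (u (n + N)) + s) \<bullet> p (snd (u (n + N)) + s)) \<longlonglongrightarrow> p (fst z + s) \<bullet> p (snd z + s)"
        using m s
        by (intro tendsto_inner isCont_tendsto_compose[OF c] tendsto_add tendsto_const
            LIMSEQ_ignore_initial_segment lim1 lim2) auto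
    qed
  qed
  then have "(\<lambda>n. gram p (fst (u n)) (snd (u n))) \<longlonglongrightarrow> gram p (fst z) (snd z)"
    by (rule LIMSEQ_offset)
  then show "(\<lambda>n. case u n of (x, y) \<Rightarrow> gram p x y) \<longlonglongrightarrow> (case z of (x, y) \<Rightarrow> gram p x y)"
    by (simp add: split_beta)
qed

text \<open>Each point \<open>u > t\<close> is counted for all \<open>x\<close> between \<open>t\<close> and \<open>u\<close>, so by Tonelli's theorem
  \<open>\<integral> gram p x x dx = \<integral> (u - t) \<parallel>p u\<parallel>\<^sup>2 du\<close>.  Equivalently, the Hankel operator with symbol \<open>p\<close> is
  Hilbert-Schmidt, and the Gram kernel is the kernel of its product with its adjoint.\<close>
lemma gram_diagonal_integrable:
  assumes weight: "integrable (ray 0) (\<lambda>s. s * (norm (p (t + s)))\<^sup>2)"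
  shows "integrable (ray t) (\<lambda>x. gram p x x)"
proof (rule integrableI_nonneg)
  have "continuous_on {t<..} (\<lambda>x. gram p x x)"
    by (intro continuous_on_kernel_compose[OF continuous_on_gram] continuous_intros) auto
  then show "(\<lambda>x. gram p x x) \<in> borel_measurable (ray t)" by (rule measurable_ray_continuous)
  show "AE x in ray t. 0 \<le> gram p x x" by (simp add: gram_def)
  define g where "g u = ennreal (indicator {t<..} u *\<^sub>R (norm (p u))\<^sup>2)" for u
  have [measurable]: "g \<in> borel_measurable borel"
  proof -
    have [measurable]: "(\<lambda>u. indicator {t<..} u *\<^sub>R (norm (p u))\<^sup>2) \<in> borel_measurable borel"
      by (intro borel_measurable_continuous_on_indicator continuous_intros cont) auto
    show ?thesis unfolding g_def by measurable
  qed
  have "(\<integral>\<^sup>+x. ennreal (gram p x x) \<partial>ray t)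
      = (\<integral>\<^sup>+x. (\<integral>\<^sup>+u. g u * indicator {x<..} u \<partial>lborel) \<partial>ray t)"
  proof (rule nn_integral_cong)
    fix x assume "x \<in> space (ray t)"
    then have x: "x > t" by (simp add: space_restrict_space)
    have "ennreal (gram p x x) = (\<integral>\<^sup>+s. ennreal (p (x + s) \<bullet> p (x + s)) \<partial>ray 0)"
      unfolding gram_def using gram_integrable[OF x x] by (simp add: nn_integral_eq_integral)
    also have "\<dots> = (\<integral>\<^sup>+s. g (x + 1 * s) * indicator {x<..} (x + 1 * s) \<partial>lborel)"
      using x by (auto simp: nn_integral_restrict_space g_def indicator_def power2_norm_eq_inner intro!: nn_integral_cong)
    also have "\<dots> = (\<integral>\<^sup>+u. g u * indicator {x<..} u \<partial>lborel)"
      by (subst nn_integral_real_affine[where c = 1 and t = x]) auto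
    finally show "ennreal (gram p x x) = (\<integral>\<^sup>+u. g u * indicator {x<..} u \<partial>lborel)" .
  qed
  also have "\<dots> = (\<integral>\<^sup>+x. (\<integral>\<^sup>+u. g u * indicator {x<..} u * indicator {t<..} x \<partial>lborel) \<partial>lborel)"
    by (simp add: nn_integral_restrict_space nn_integral_multc)
  also have "\<dots> = (\<integral>\<^sup>+u. (\<integral>\<^sup>+x. g u * indicator {x<..} u * indicator {t<..} x \<partial>lborel) \<partial>lborel)"
  proof (rule lborel_pair.Fubini')
    have "(\<lambda>z. g (fst z) * (if snd z < fst z then 1 else 0) * (if t < snd z then 1 else 0))
        \<in> borel_measurable (borel \<Otimes>\<^sub>M borel)"
      by measurable
    then show "(\<lambda>(u, x). g u * indicator {x<..} u * indicator {t<..} x) \<in> borel_measurable (lborel \<Otimes>\<^sub>M lborel)"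
      by (simp add: split_beta indicator_def)
  qed
  also have "\<dots> = (\<integral>\<^sup>+u. g u * ennreal (u - t) \<partial>lborel)"
  proof (rule nn_integral_cong)
    fix u
    have "(\<integral>\<^sup>+x. g u * indicator {x<..} u * indicator {t<..} x \<partial>lborel) = (\<integral>\<^sup>+x. g u * indicator {t<..<u} x \<partial>lborel)"
      by (intro nn_integral_cong) (auto simp: indicator_def)
    also have "\<dots> = g u * emeasure lborel {t<..<u}"
      by (simp add: nn_integral_cmult_indicator)
    also have "\<dots> = g u * ennreal (u - t)"
      by (cases "t \<le> u") (auto simp: ennreal_neg)
    finally show "(\<integral>\<^sup>+x. g u * indicator {x<..} u * indicator {t<..} x \<partial>lborel) = g u * ennreal (u - t)" .
  qed
  also have "\<dots> = (\<integral>\<^sup>+s. g (t + 1 * s) * ennreal (t + 1 * s - t) \<partial>lborel)"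
    by (subst nn_integral_real_affine[where c = 1 and t = t]) auto
  also have "\<dots> = (\<integral>\<^sup>+s. ennreal (s * (norm (p (t + s)))\<^sup>2) \<partial>ray 0)"
    by (auto simp: nn_integral_restrict_space g_def indicator_def ennreal_mult' mult.commute intro!: nn_integral_cong)
  also have "\<dots> = ennreal (\<integral>s. s * (norm (p (t + s)))\<^sup>2 \<partial>ray 0)"
    using weight by (intro nn_integral_eq_integral AE_I2) (auto simp: space_restrict_space)
  also have "\<dots> < \<infinity>" by simp
  finally show "(\<integral>\<^sup>+x. ennreal (gram p x x) \<partial>ray t) < \<infinity>" .
qed

end

section \<open>Traceless two by two matrices\<close>

lemma J_mat_mult [simp]: "(J_mat *v x) $ 1 = - x $ 2" "(J_mat *v x) $ 2 = x $ 1"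
  by (simp_all add: J_mat_def matrix_vector_mult_def sum_2)

lemma J_mat_nth [simp]:
  "J_mat $ 1 $ 1 = 0" "J_mat $ 1 $ 2 = - 1" "J_mat $ 2 $ 1 = 1" "J_mat $ 2 $ 2 = 0"
  by (simp_all add: J_mat_def)

lemma inner_real2: "x \<bullet> y = x $ 1 * y $ 1 + x $ 2 * y $ 2" for x y :: "real^2"
  by (simp add: inner_vec_def sum_2)

lemma matrix_vector_mult_real2:
  fixes A :: "real^2^2"
  shows "(A *v x) $ 1 = A $ 1 $ 1 * x $ 1 + A $ 1 $ 2 * x $ 2"
    and "(A *v x) $ 2 = A $ 2 $ 1 * x $ 1 + A $ 2 $ 2 * x $ 2"
  by (simp_all add: matrix_vector_mult_def sum_2)

lemma J_mat_inner_self [simp]: "(J_mat *v x) \<bullet> x = 0"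
  by (simp add: inner_real2)

text \<open>That is, \<open>J A\<close> is symmetric: traceless matrices form the Lie algebra of the symplectic group of the
  plane.\<close>
lemma traceless_J_mat:
  fixes A :: "real^2^2"
  assumes "A $ 1 $ 1 + A $ 2 $ 2 = 0"
  shows "(J_mat *v x) \<bullet> (A *v y) = - ((J_mat *v (A *v x)) \<bullet> y)"
proof -
  have "A $ 2 $ 2 = - A $ 1 $ 1" using assms by simp
  then show ?thesis by (simp add: inner_real2 matrix_vector_mult_real2 algebra_simps)
qed

text \<open>The Cayley-Hamilton theorem.\<close>
lemma traceless_square:
  fixes A :: "real^2^2"
  assumes "A $ 1 $ 1 + A $ 2 $ 2 = 0"
  shows "A *v (A *v x) = (- det A) *\<^sub>R x"
proof -
  have "A $ 2 $ 2 = - A $ 1 $ 1" using assms by simp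
  then show ?thesis
    by (simp add: vec_eq_iff forall_2 matrix_vector_mult_real2 det_2 algebra_simps)
qed

text \<open>The symmetric matrix \<open>J A\<close> has determinant \<open>det A \<le> 0\<close>, so it has at most one positive and one
  negative eigenvalue and its form is a difference of two squares.  The two linear forms can be chosen
  to vanish on the kernel of \<open>J A\<close>, which is that of \<open>A\<close>; they are therefore linear forms in \<open>A x\<close>.
  This is what makes an estimate of \<open>A x\<close>, rather than of \<open>x\<close>, sufficient later on.\<close>
lemma traceless_signature:
  fixes A :: "real^2^2"
  assumes tr: "A $ 1 $ 1 + A $ 2 $ 2 = 0" and det: "det A \<le> 0"
  shows "\<exists>p q :: real^2. \<forall>x y. (J_mat *v (A *v x)) \<bullet> y
           = (p \<bullet> (A *v x)) * (p \<bullet> (A *v y)) - (q \<bullet> (A *v x)) * (q \<bullet> (A *v y))"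
proof -
  \<comment> \<open>replacing \<open>A\<close> by \<open>- A\<close> exchanges the two squares, so half of the sign patterns suffice\<close>
  have pos: "\<exists>p q :: real^2. \<forall>x y. (J_mat *v (A *v x)) \<bullet> y
           = (p \<bullet> (A *v x)) * (p \<bullet> (A *v y)) - (q \<bullet> (A *v x)) * (q \<bullet> (A *v y))"
    if tr: "A $ 1 $ 1 + A $ 2 $ 2 = 0" and det: "det A \<le> 0"
      and sign: "A $ 2 $ 1 < 0 \<or> A $ 2 $ 1 = 0 \<and> (A $ 1 $ 1 = 0 \<longrightarrow> A $ 1 $ 2 \<ge> 0)" for A :: "real^2^2"
  proof -
    define a b d D where "a = - A $ 2 $ 1" and "b = A $ 1 $ 1" and "d = A $ 1 $ 2" and "D = b\<^sup>2 - a * d"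
    have A: "A $ 2 $ 1 = - a" "A $ 1 $ 1 = b" "A $ 1 $ 2 = d" "A $ 2 $ 2 = - b"
      using tr by (auto simp: a_def b_def d_def)
    have D: "D \<ge> 0" using det by (simp add: det_2 A D_def power2_eq_square mult.commute)
    have J: "(J_mat *v (A *v x)) \<bullet> y = a * (x $ 1 * y $ 1) + b * (x $ 2 * y $ 1 + x $ 1 * y $ 2) + d * (x $ 2 * y $ 2)" for x y
      by (simp add: inner_real2 matrix_vector_mult_real2 A algebra_simps)
    consider "a > 0" | "a = 0" "b \<noteq> 0" | "a = 0" "b = 0" "d \<ge> 0"
      using sign by (auto simp: a_def b_def d_def)
    then show ?thesis
    proof cases
      case 1
      define p :: "real^2" where "p = vector [0, - 1 / sqrt a]"
      \<comment> \<open>completing the square: \<open>a u\<^sup>2 + 2 b u v + d v\<^sup>2 = (a u + b v)\<^sup>2 / a - D v\<^sup>2 / a\<close>; for \<open>D = 0\<close>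
        division by zero makes \<open>q = 0\<close>, as required\<close>
      define r where "r = 1 / sqrt (a * D)"
      define q :: "real^2" where "q = vector [- a * r, - b * r]"
      have p: "p \<bullet> (A *v x) = (a * x $ 1 + b * x $ 2) / sqrt a" for x
        using 1 by (simp add: inner_real2 p_def matrix_vector_mult_real2 A field_simps)
      have "q \<bullet> (A *v x) = D * x $ 2 * r" for x
        by (simp add: inner_real2 q_def matrix_vector_mult_real2 A D_def power2_eq_square algebra_simps)
      then have q: "q \<bullet> (A *v x) = D * x $ 2 / sqrt (a * D)" for x by (simp add: r_def)
      have qq: "(q \<bullet> (A *v x)) * (q \<bullet> (A *v y)) = D * (x $ 2 * y $ 2) / a" for x y
        using 1 D by (simp add: q)
      have pp: "(p \<bullet> (A *v x)) * (p \<bullet> (A *v y)) = (a * x $ 1 + b * x $ 2) * (a * y $ 1 + b * y $ 2) / a" for x y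
        using 1 by (simp add: p)
      show ?thesis
        by (rule exI[of _ p], rule exI[of _ q], use 1 in \<open>simp add: J pp qq D_def power2_eq_square field_simps\<close>)
    next
      case 2
      \<comment> \<open>polarisation: \<open>v (2 b u + d v) = (b u / 2 + (d / 4 + 1) v)\<^sup>2 - (b u / 2 + (d / 4 - 1) v)\<^sup>2\<close>\<close>
      define p :: "real^2" where "p = vector [1 / 2, (d / 4 - 1) / b]"
      define q :: "real^2" where "q = vector [1 / 2, (d / 4 + 1) / b]"
      have p: "p \<bullet> (A *v x) = b * x $ 1 / 2 + (d / 4 + 1) * x $ 2" for x
        using 2 by (simp add: inner_real2 p_def matrix_vector_mult_real2 A field_simps)
      have q: "q \<bullet> (A *v x) = b * x $ 1 / 2 + (d / 4 - 1) * x $ 2" for x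
        using 2 by (simp add: inner_real2 q_def matrix_vector_mult_real2 A field_simps)
      show ?thesis
        by (rule exI[of _ p], rule exI[of _ q], use 2 in \<open>simp add: J p q field_simps\<close>)
    next
      case 3
      define p :: "real^2" where "p = vector [1 / sqrt d, 0]"
      have p: "p \<bullet> (A *v x) = sqrt d * x $ 2" for x
      proof -
        have "p \<bullet> (A *v x) = (d / sqrt d) * x $ 2"
          using 3 by (simp add: inner_real2 p_def matrix_vector_mult_real2 A)
        then show ?thesis using 3 by (simp only: real_div_sqrt)
      qed
      show ?thesis
        by (rule exI[of _ p], rule exI[of _ "0 :: real^2"], use 3 in \<open>simp add: J p\<close>)
    qed
  qed
  show ?thesis
  proof (cases "A $ 2 $ 1 < 0 \<or> A $ 2 $ 1 = 0 \<and> (A $ 1 $ 1 = 0 \<longrightarrow> A $ 1 $ 2 \<ge> 0)")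
    case True
    then show ?thesis by (rule pos[OF tr det])
  next
    case False
    obtain p q :: "real^2" where pq: "\<And>x y. (J_mat *v (- A *v x)) \<bullet> y
           = (p \<bullet> (- A *v x)) * (p \<bullet> (- A *v y)) - (q \<bullet> (- A *v x)) * (q \<bullet> (- A *v y))"
    proof -
      have "det (- A) \<le> 0" using det by (simp add: det_2)
      moreover have "(- A) $ 1 $ 1 + (- A) $ 2 $ 2 = 0" using tr by simp
      moreover have "(- A) $ 2 $ 1 < 0 \<or> (- A) $ 2 $ 1 = 0 \<and> ((- A) $ 1 $ 1 = 0 \<longrightarrow> (- A) $ 1 $ 2 \<ge> 0)"
        using False by auto
      ultimately show thesis using pos[of "- A"] that by blast
    qed
    have neg: "- A *v x = - (A *v x)" for x
      by (simp add: vec_eq_iff forall_2 matrix_vector_mult_real2)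
    have Jneg: "J_mat *v (- x) = - (J_mat *v x)" for x
      by (simp add: vec_eq_iff forall_2)
    show ?thesis
    proof (rule exI[of _ q], rule exI[of _ p], intro allI)
      fix x y
      from pq[of x y]
      show "(J_mat *v (A *v x)) \<bullet> y
          = (q \<bullet> (A *v x)) * (q \<bullet> (A *v y)) - (p \<bullet> (A *v x)) * (p \<bullet> (A *v y))"
        unfolding neg Jneg inner_minus_right inner_minus_left by simp
    qed
  qed
qed

section \<open>Bounded solutions of Fuchsian systems beyond the last pole\<close>

lemma norm_bounded_derivative_bound:
  fixes f :: "real \<Rightarrow> 'b::euclidean_space"
  assumes "\<And>z. z \<ge> a \<Longrightarrow> (f has_vector_derivative f' z) (at z)"
    and "\<And>z. z \<ge> a \<Longrightarrow> norm (f' z) \<le> B" and "x \<ge> a" "y \<ge> a"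
  shows "norm (f x - f y) \<le> B * \<bar>x - y\<bar>"
proof -
  have "norm (f x - f y) \<le> B * norm (x - y)"
  proof (rule differentiable_bound[of "{a..}" f "\<lambda>z h. h *\<^sub>R f' z"])
    show "(f has_derivative (\<lambda>h. h *\<^sub>R f' z)) (at z within {a..})" if "z \<in> {a..}" for z
      using assms(1)[of z] that unfolding has_vector_derivative_def
      by (auto dest: has_derivative_at_withinI)
    show "onorm (\<lambda>h. h *\<^sub>R f' z) \<le> B" if "z \<in> {a..}" for z
      using assms(2)[of z] that by (intro onorm_le) (auto simp: mult.commute[of B] mult_left_mono)
  qed (use assms in auto)
  then show ?thesis by simp
qed

text \<open>The primitive is monotone and bounded below, hence has a limit at \<open>0\<close>.\<close>
lemma integrable_of_bounded_primitive:
  fixes F h :: "real \<Rightarrow> real"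
  assumes deriv: "\<And>s. s > 0 \<Longrightarrow> (F has_real_derivative h s) (at s)"
    and cont: "continuous_on {0<..} h"
    and nonneg: "\<And>s. s > 0 \<Longrightarrow> h s \<ge> 0" and below: "\<And>s. s > 0 \<Longrightarrow> F s \<ge> K"
  shows "set_integrable lborel {0<..<1} h"
proof -
  have "F a \<le> F b" if "0 < a" "a \<le> b" for a b
  proof (rule DERIV_nonneg_imp_nondecreasing[OF that(2)])
    fix x assume "a \<le> x"
    with \<open>0 < a\<close> have "x > 0" by linarith
    with deriv nonneg show "\<exists>y. (F has_real_derivative y) (at x) \<and> 0 \<le> y" by blast
  qed
  then have lim: "(F \<longlongrightarrow> Inf (F ` ({0<..} \<inter> UNIV))) (at 0 within ({0<..} \<inter> UNIV))"
    using below by (intro Lim_right_bound) auto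
  have "set_integrable lborel (einterval (ereal 0) (ereal 1)) h"
  proof (rule interval_integral_FTC_nonneg)
    show "DERIV F x :> h x" if "ereal 0 < ereal x" for x using that deriv by simp
    show "isCont h x" if "ereal 0 < ereal x" for x
      using that cont by (simp add: continuous_on_eq_continuous_at)
    show "AE x in lborel. ereal 0 < ereal x \<longrightarrow> ereal x < ereal 1 \<longrightarrow> 0 \<le> h x"
      using nonneg by simp
    show "((F \<circ> real_of_ereal) \<longlongrightarrow> Inf (F ` ({0<..} \<inter> UNIV))) (at_right (ereal 0))"
      using lim by (subst ereal_tendsto_simps1(2)) simp
    have "isCont F 1" using deriv[of 1] by (simp add: DERIV_isCont)
    then have "(F \<longlongrightarrow> F 1) (at_left 1)" by (simp add: isCont_def filterlim_at_split)
    then show "((F \<circ> real_of_ereal) \<longlongrightarrow> F 1) (at_left (ereal 1))"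
      by (subst ereal_tendsto_simps1(1)) simp
  qed simp
  then show ?thesis by (simp del: zero_ereal_def)
qed

text \<open>The pole \<open>c m\<close> at the end point of the ray is singled out: all others stay at a positive distance
  from the ray, so the terms that they contribute are bounded.\<close>
locale fuchsian_solution =
  fixes W :: "'n::finite \<Rightarrow> real^2^2" and c :: "'n \<Rightarrow> real" and m :: 'n
    and t :: real and f :: "real \<Rightarrow> real^2"
  assumes trace: "\<And>i. W i $ 1 $ 1 + W i $ 2 $ 2 = 0" and det: "\<And>i. det (W i) \<le> 0"
    and pole: "c m = t" and other_pole: "\<And>i. i \<noteq> m \<Longrightarrow> c i < t" and t_pos: "t > 0"
    and ode: "\<And>x. x > t \<Longrightarrow> (f has_vector_derivative (\<Sum>i\<in>UNIV. (1 / (x - c i)) *\<^sub>R (W i *v f x))) (at x)"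
    and bounded_f: "bounded (f ` {t<..})"
    and L2: "integrable (ray t) (\<lambda>x. (norm (f x))\<^sup>2 / x)"
begin

lemma c_le: "c i \<le> t"
  using pole other_pole[of i] by (cases "i = m") auto

lemma continuous_on_f: "continuous_on {t<..} f"
  using ode by (intro continuous_at_imp_continuous_on ballI has_vector_derivative_continuous) auto

lemma isCont_f: "x > t \<Longrightarrow> isCont f x"
  using ode has_vector_derivative_continuous by blast

definition f_bound where "f_bound = (SOME f_bound. \<forall>x>t. norm (f x) \<le> f_bound)"

lemma norm_f_le: "x > t \<Longrightarrow> norm (f x) \<le> f_bound"
proof -
  have "\<exists>f_bound. \<forall>x>t. norm (f x) \<le> f_bound" using bounded_f by (auto simp: bounded_iff)
  then show "x > t \<Longrightarrow> norm (f x) \<le> f_bound" unfolding f_bound_def by (rule someI2_ex) blast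
qed

lemma f_bound_nonneg: "f_bound \<ge> 0"
  using order_trans[OF norm_ge_zero norm_f_le[of "t + 1"]] by simp

definition W_bound where "W_bound = (\<Sum>i\<in>UNIV. onorm ((*v) (W i)))"

lemma W_bound_nonneg: "W_bound \<ge> 0"
  unfolding W_bound_def by (intro sum_nonneg onorm_pos_le matrix_vector_mul_bounded_linear)

lemma norm_W_le: "norm (W i *v x) \<le> W_bound * norm x"
proof -
  have "onorm ((*v) (W i)) \<le> W_bound"
    unfolding W_bound_def by (intro member_le_sum onorm_pos_le matrix_vector_mul_bounded_linear) auto
  then show ?thesis
    using order_trans[OF onorm[OF matrix_vector_mul_bounded_linear] mult_right_mono[OF _ norm_ge_zero]] by blast
qed

lemma norm_W_f_le: "x > t \<Longrightarrow> norm (W i *v f x) \<le> W_bound * f_bound"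
  using order_trans[OF norm_W_le mult_left_mono[OF norm_f_le W_bound_nonneg]] by blast

text \<open>The entries of the Hankel symbols: with \<open>v i\<close> the two vectors provided by
  \<open>traceless_signature\<close> for \<open>W i\<close>, these are the two halves of \<open>\<phi>\<close>.\<close>
definition hankel_symbol :: "('n \<Rightarrow> real^2) \<Rightarrow> real \<Rightarrow> real^'n" where
  "hankel_symbol v x = (\<chi> i. (v i \<bullet> (W i *v f x)) / (x - c i))"

lemma continuous_on_W_f: "continuous_on {t<..} (\<lambda>x. W i *v f x)"
  by (intro continuous_on_compose2[OF matrix_vector_mult_linear_continuous_on continuous_on_f]) auto

lemma continuous_on_hankel_symbol: "continuous_on {t<..} (hankel_symbol v)"
  unfolding hankel_symbol_def using c_le
  by (intro continuous_intros continuous_on_W_f) (auto simp: less_le_not_le)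

lemma hankel_symbol_le: "\<exists>C. \<forall>x>t. norm (hankel_symbol v x) \<le> C / (x - t)"
proof (intro exI allI impI)
  fix x assume x: "x > t"
  have "norm (hankel_symbol v x) \<le> (\<Sum>i\<in>UNIV. \<bar>hankel_symbol v x $ i\<bar>)" by (rule norm_le_l1_cart)
  also have "\<dots> \<le> (\<Sum>i\<in>UNIV. norm (v i) * (W_bound * f_bound) / (x - t))"
  proof (rule sum_mono)
    fix i
    have "\<bar>v i \<bullet> (W i *v f x)\<bar> \<le> norm (v i) * (W_bound * f_bound)"
      using order_trans[OF Cauchy_Schwarz_ineq2 mult_left_mono[OF norm_W_f_le[OF x] norm_ge_zero]] .
    then show "\<bar>hankel_symbol v x $ i\<bar> \<le> norm (v i) * (W_bound * f_bound) / (x - t)"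
      using x c_le[of i] by (auto simp: hankel_symbol_def intro!: frac_le)
  qed
  also have "\<dots> = (\<Sum>i\<in>UNIV. norm (v i) * (W_bound * f_bound)) / (x - t)"
    by (simp add: sum_divide_distrib)
  finally show "norm (hankel_symbol v x) \<le> (\<Sum>i\<in>UNIV. norm (v i) * (W_bound * f_bound)) / (x - t)" .
qed

lemma f_shift_derivative:
  assumes "z + s > t"
  shows "((\<lambda>s. f (z + s)) has_vector_derivative (\<Sum>i\<in>UNIV. (1 / (z + s - c i)) *\<^sub>R (W i *v f (z + s)))) (at s)"
proof -
  have "((\<lambda>s. z + s) has_vector_derivative 1) (at s)"
    by (auto intro!: derivative_eq_intros simp flip: has_real_derivative_iff_has_vector_derivative)
  from vector_diff_chain_at[OF this ode[OF assms]] show ?thesis by (simp add: o_def)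
qed

text \<open>The energy identity at the pole.  Along the solution the derivative of \<open>\<langle>W\<^sub>m f, f\<rangle>\<close> contains the
  term \<open>(\<parallel>W\<^sub>m f\<parallel>\<^sup>2 + \<langle>W\<^sub>m\<^sup>2 f, f\<rangle>) / s\<close>, which is at least \<open>\<parallel>W\<^sub>m f\<parallel>\<^sup>2 / s\<close> because
  \<open>W\<^sub>m\<^sup>2 = - det W\<^sub>m \<ge> 0\<close>; the other poles contribute a bounded amount.  Boundedness of \<open>f\<close> thus excludes
  the singular solutions.\<close>
lemma square_integrable_near_pole:
  "set_integrable lborel {0<..<1} (\<lambda>s. (norm (W m *v f (t + s)))\<^sup>2 / s)"
proof -
  define g where "g s = f (t + s)" for s
  define r where "r i s = 1 / (t + s - c i) * ((W m *v (W i *v g s)) \<bullet> g s + (W m *v g s) \<bullet> (W i *v g s))" for i s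
  define R where "R = (\<Sum>i\<in>UNIV - {m}. 1 / (t - c i) * (2 * (W_bound * (W_bound * f_bound) * f_bound)))"
  define h where "h s = (\<Sum>i\<in>UNIV. r i s) + R" for s
  \<comment> \<open>the linear term absorbs the contribution of the other poles and makes \<open>F\<close> monotone\<close>
  define F where "F s = (W m *v g s) \<bullet> g s + R * s" for s
  have g: "norm (g s) \<le> f_bound" and Wg: "norm (W i *v g s) \<le> W_bound * f_bound" if "s > 0" for s i
    using norm_f_le[of "t + s"] norm_W_f_le[of "t + s"] that by (auto simp: g_def)
  have R: "R \<ge> 0"
    unfolding R_def using c_le W_bound_nonneg f_bound_nonneg by (intro sum_nonneg mult_nonneg_nonneg) auto
  have h_ge: "(norm (W m *v g s))\<^sup>2 / s \<le> h s" if s: "s > 0" for s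
  proof -
    have rm: "r m s = (1 / s) * (- det (W m)) * (g s \<bullet> g s) + (norm (W m *v g s))\<^sup>2 / s"
      unfolding r_def traceless_square[OF trace] by (simp add: pole power2_norm_eq_inner diff_divide_distrib)
    have "(\<Sum>i\<in>UNIV - {m}. - r i s) \<le> R"
      unfolding R_def
    proof (rule sum_mono)
      fix i assume "i \<in> UNIV - {m}"
      then have ci: "c i < t" using other_pole by auto
      have "\<bar>(W m *v (W i *v g s)) \<bullet> g s\<bar> \<le> norm (W m *v (W i *v g s)) * norm (g s)"
        by (rule Cauchy_Schwarz_ineq2)
      also have "\<dots> \<le> (W_bound * (W_bound * f_bound)) * f_bound"
        using order_trans[OF norm_W_le mult_left_mono[OF Wg[OF s] W_bound_nonneg]] g[OF s] W_bound_nonneg f_bound_nonneg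
        by (intro mult_mono) auto
      finally have 1: "\<bar>(W m *v (W i *v g s)) \<bullet> g s\<bar> \<le> W_bound * (W_bound * f_bound) * f_bound" .
      have "\<bar>(W m *v g s) \<bullet> (W i *v g s)\<bar> \<le> norm (W m *v g s) * norm (W i *v g s)"
        by (rule Cauchy_Schwarz_ineq2)
      also have "\<dots> \<le> (W_bound * f_bound) * (W_bound * f_bound)"
        using Wg[OF s] W_bound_nonneg f_bound_nonneg by (intro mult_mono) auto
      finally have 2: "\<bar>(W m *v g s) \<bullet> (W i *v g s)\<bar> \<le> W_bound * (W_bound * f_bound) * f_bound" by (simp add: mult_ac)
      have "- r i s = 1 / (t + s - c i) * (- ((W m *v (W i *v g s)) \<bullet> g s) - (W m *v g s) \<bullet> (W i *v g s))"
        by (simp add: r_def diff_divide_distrib add_divide_distrib)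
      also have "\<dots> \<le> 1 / (t + s - c i) * (2 * (W_bound * (W_bound * f_bound) * f_bound))"
        using 1 2 ci s by (intro mult_left_mono) auto
      also have "\<dots> \<le> 1 / (t - c i) * (2 * (W_bound * (W_bound * f_bound) * f_bound))"
        using ci s W_bound_nonneg f_bound_nonneg by (intro mult_right_mono frac_le) auto
      finally show "- r i s \<le> 1 / (t - c i) * (2 * (W_bound * (W_bound * f_bound) * f_bound))" .
    qed
    then have "0 \<le> (\<Sum>i\<in>UNIV - {m}. r i s) + R" by (simp add: sum_negf)
    moreover have "0 \<le> (1 / s) * (- det (W m)) * (g s \<bullet> g s)"
      using s det[of m] by (intro mult_nonneg_nonneg) auto
    moreover have "h s = r m s + (\<Sum>i\<in>UNIV - {m}. r i s) + R"
      unfolding h_def by (simp add: sum.remove[of UNIV m])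
    ultimately show ?thesis using rm by linarith
  qed
  have cont_g: "continuous_on {0<..} g"
    unfolding g_def by (intro continuous_on_compose2[OF continuous_on_f] continuous_intros) auto
  have cont_W: "continuous_on {0<..} (\<lambda>s. W i *v k s)" if "continuous_on {0<..} k" for i k
    by (intro continuous_on_compose2[OF matrix_vector_mult_linear_continuous_on that]) auto
  have "set_integrable lborel {0<..<1} h"
  proof (rule integrable_of_bounded_primitive)
    fix s :: real assume s: "s > 0"
    have dg: "(g has_vector_derivative (\<Sum>i\<in>UNIV. (1 / (t + s - c i)) *\<^sub>R (W i *v g s))) (at s)"
      unfolding g_def using s by (intro f_shift_derivative) auto
    have dWg: "((\<lambda>s. W m *v g s) has_vector_derivative (W m *v (\<Sum>i\<in>UNIV. (1 / (t + s - c i)) *\<^sub>R (W i *v g s)))) (at s)"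
      by (rule bounded_linear.has_vector_derivative[OF matrix_vector_mul_bounded_linear dg])
    have "((\<lambda>s. (W m *v g s) \<bullet> g s) has_vector_derivative
        ((W m *v g s) \<bullet> (\<Sum>i\<in>UNIV. (1 / (t + s - c i)) *\<^sub>R (W i *v g s))
         + (W m *v (\<Sum>i\<in>UNIV. (1 / (t + s - c i)) *\<^sub>R (W i *v g s))) \<bullet> g s)) (at s)"
      by (rule bounded_bilinear.has_vector_derivative[OF bounded_bilinear_inner dWg dg])
    also have "(W m *v g s) \<bullet> (\<Sum>i\<in>UNIV. (1 / (t + s - c i)) *\<^sub>R (W i *v g s))
         + (W m *v (\<Sum>i\<in>UNIV. (1 / (t + s - c i)) *\<^sub>R (W i *v g s))) \<bullet> g s = (\<Sum>i\<in>UNIV. r i s)"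
      by (simp add: r_def linear_sum[OF matrix_vector_mul_linear] inner_sum_left inner_sum_right
          matrix_vector_mult_scaleR sum.distrib[symmetric] distrib_left add.commute)
    finally show "(F has_real_derivative h s) (at s)"
      unfolding F_def h_def has_real_derivative_iff_has_vector_derivative
      by (intro has_vector_derivative_add) (auto intro!: derivative_eq_intros simp: has_real_derivative_iff_has_vector_derivative[symmetric])
    have "0 \<le> (norm (W m *v g s))\<^sup>2 / s" using s by simp
    with h_ge[OF s] show "0 \<le> h s" by linarith
    have "\<bar>(W m *v g s) \<bullet> g s\<bar> \<le> norm (W m *v g s) * norm (g s)" by (rule Cauchy_Schwarz_ineq2)
    also have "\<dots> \<le> (W_bound * f_bound) * f_bound" using Wg[OF s] g[OF s] W_bound_nonneg f_bound_nonneg by (intro mult_mono) auto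
    finally show "- ((W_bound * f_bound) * f_bound) \<le> F s" 
      using mult_nonneg_nonneg[OF R less_imp_le[OF s]] unfolding F_def by linarith
  next
    show "continuous_on {0<..} h"
      unfolding h_def r_def
    proof (intro continuous_intros cont_W cont_g ballI)
      fix i s assume "s \<in> {0::real<..}"
      then show "t + s - c i \<noteq> 0" using c_le[of i] by auto
    qed
  qed
  then show ?thesis
  proof (rule set_integrable_bound)
    have "continuous_on {0<..<1} (\<lambda>s. (norm (W m *v g s))\<^sup>2 / s)"
      by (intro continuous_intros continuous_on_subset[OF cont_W[OF cont_g]]) auto
    from borel_measurable_continuous_on_indicator[OF _ this]
    show "set_borel_measurable lborel {0<..<1} (\<lambda>s. (norm (W m *v f (t + s)))\<^sup>2 / s)"
      unfolding g_def set_borel_measurable_def by simp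
    show "AE s in lborel. s \<in> {0<..<1} \<longrightarrow> norm ((norm (W m *v f (t + s)))\<^sup>2 / s) \<le> norm (h s)"
      using h_ge by (auto simp: g_def intro!: AE_I2 order_trans[OF _ abs_ge_self])
  qed
qed

text \<open>Away from the pole \<open>t\<close>, and at infinity also for the pole \<open>t\<close>, the weight \<open>s / (t + s - c i)\<^sup>2\<close> is at
  most a multiple of \<open>1 / (t + s)\<close>, so the hypothesis on \<open>f\<close> applies; what is left is the last pole
  with \<open>s < 1\<close>, settled by the energy identity.\<close>
lemma hankel_symbol_weight_integrable: "integrable (ray 0) (\<lambda>s. s * (norm (hankel_symbol v (t + s)))\<^sup>2)"
proof -
  let ?u = "\<lambda>s. (norm (f (t + s)))\<^sup>2 / (t + s)"
  have "integrable lborel (\<lambda>x. indicator {t<..} x *\<^sub>R ((norm (f x))\<^sup>2 / x))"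
    using L2 by (simp add: integrable_ray_iff set_integrable_def)
  then have "integrable lborel (\<lambda>s. indicator {t<..} (t + 1 * s) *\<^sub>R ((norm (f (t + 1 * s)))\<^sup>2 / (t + 1 * s)))"
    by (rule lborel_integrable_real_affine) simp
  then have tail: "integrable (ray 0) ?u"
    by (simp add: integrable_ray_iff set_integrable_def indicator_def)
  let ?w = "\<lambda>s. indicator {0<..<1} s * ((norm (W m *v f (t + s)))\<^sup>2 / s)"
  have near: "integrable (ray 0) ?w"
  proof -
    have "(\<lambda>s. indicator {0<..} s *\<^sub>R ?w s)
        = (\<lambda>s. indicator {0<..<1} s *\<^sub>R ((norm (W m *v f (t + s)))\<^sup>2 / s))"
      by (auto simp: fun_eq_iff indicator_def)
    then show ?thesis
      using square_integrable_near_pole by (simp only: integrable_ray_iff set_integrable_def)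
  qed
  have each: "integrable (ray 0) (\<lambda>s. s * (hankel_symbol v (t + s) $ i)\<^sup>2)" for i
  proof -
    define K where "K = (norm (v i))\<^sup>2 * W_bound\<^sup>2 * (if i = m then 1 + t else 1 + t / (t - c i))"
    have bnd: "integrable (ray 0) (\<lambda>s. K * ?u s + (norm (v i))\<^sup>2 * ?w s)"
      using tail near by (intro Bochner_Integration.integrable_add integrable_mult_right)
    show ?thesis
    proof (rule Bochner_Integration.integrable_bound[OF bnd])
      show "(\<lambda>s. s * (hankel_symbol v (t + s) $ i)\<^sup>2) \<in> borel_measurable (ray 0)"
        by (intro measurable_ray_continuous continuous_intros continuous_on_compose2[OF continuous_on_hankel_symbol]) auto
      show "AE s in ray 0. norm (s * (hankel_symbol v (t + s) $ i)\<^sup>2) \<le> norm (K * ?u s + (norm (v i))\<^sup>2 * ?w s)"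
      proof (rule AE_I2)
        fix s assume "s \<in> space (ray 0)"
        then have s: "s > 0" by (simp add: space_restrict_space)
        define d where "d = t - c i"
        have d: "d \<ge> 0" "i \<noteq> m \<Longrightarrow> d > 0" "i = m \<Longrightarrow> d = 0"
          using c_le[of i] other_pole[of i] pole by (auto simp: d_def)
        let ?a = "(v i \<bullet> (W i *v f (t + s)))\<^sup>2"
        have lhs: "s * (hankel_symbol v (t + s) $ i)\<^sup>2 = ?a * (s / (s + d)\<^sup>2)"
          by (simp add: hankel_symbol_def d_def power_divide algebra_simps)
        have a1: "?a \<le> (norm (v i))\<^sup>2 * (norm (W i *v f (t + s)))\<^sup>2"
          using power_mono[OF Cauchy_Schwarz_ineq2[of "v i" "W i *v f (t + s)"] abs_ge_zero, of 2]
          by (simp add: power_mult_distrib)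
        have "(norm (W i *v f (t + s)))\<^sup>2 \<le> W_bound\<^sup>2 * (norm (f (t + s)))\<^sup>2"
          using power_mono[OF norm_W_le[of i "f (t + s)"] norm_ge_zero, of 2] by (simp add: power_mult_distrib)
        then have a2: "?a \<le> (norm (v i))\<^sup>2 * W_bound\<^sup>2 * (norm (f (t + s)))\<^sup>2"
          using order_trans[OF a1 mult_left_mono[of _ _ "(norm (v i))\<^sup>2"]] by (simp add: mult.assoc)
        have pos: "0 \<le> ?w s" "0 \<le> K * ?u s"
          using s t_pos d by (auto simp: K_def d_def)
        have far: "?a * (s / (s + d)\<^sup>2) \<le> K * ?u s"
          if q: "s / (s + d)\<^sup>2 \<le> (if i = m then 1 + t else 1 + t / d) / (t + s)"
        proof -
          have "?a * (s / (s + d)\<^sup>2) \<le> ((norm (v i))\<^sup>2 * W_bound\<^sup>2 * (norm (f (t + s)))\<^sup>2) * ((if i = m then 1 + t else 1 + t / d) / (t + s))"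
            using a2 q s by (intro mult_mono) auto
          also have "\<dots> = K * ?u s" by (simp add: K_def d_def)
          finally show ?thesis .
        qed
        have "?a * (s / (s + d)\<^sup>2) \<le> K * ?u s + (norm (v i))\<^sup>2 * ?w s"
        proof (cases "i = m \<and> s < 1")
          case True
          then have "?a * (s / (s + d)\<^sup>2) = ?a / s"
            using d(3) s by (simp add: power2_eq_square)
          also have "\<dots> \<le> (norm (v i))\<^sup>2 * (norm (W i *v f (t + s)))\<^sup>2 / s"
            using a1 s by (intro divide_right_mono) auto
          also have "\<dots> = (norm (v i))\<^sup>2 * ?w s" using True s by simp
          finally show ?thesis using pos by linarith
        next
          case False
          have "s / (s + d)\<^sup>2 \<le> (if i = m then 1 + t else 1 + t / d) / (t + s)"
          proof (cases "i = m")
            case True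
            with False have "s \<ge> 1" by simp
            then have "t * 1 \<le> t * s" using t_pos by (intro mult_left_mono) auto
            with True d(3) s t_pos show ?thesis
              by (simp add: power2_eq_square divide_simps distrib_right)
          next
            case False
            with d have d0: "d > 0" by simp
            have "t + s \<le> (1 + t / d) * (s + d)"
              using d0 s t_pos by (simp add: field_simps)
            then have "s * (t + s) \<le> (s + d) * ((1 + t / d) * (s + d))"
              using s d0 t_pos by (intro mult_mono) auto
            then have "s * (t + s) \<le> (1 + t / d) * (s + d)\<^sup>2"
              by (simp add: power2_eq_square mult_ac)
            with False s d0 t_pos show ?thesis by (simp add: pos_divide_le_eq pos_le_divide_eq)
          qed
          from far[OF this] show ?thesis using pos mult_nonneg_nonneg[OF zero_le_power2[of "norm (v i)"] pos(1)] by linarith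
        qed
        moreover have "0 \<le> s * (hankel_symbol v (t + s) $ i)\<^sup>2" using s by simp
        ultimately show "norm (s * (hankel_symbol v (t + s) $ i)\<^sup>2) \<le> norm (K * ?u s + (norm (v i))\<^sup>2 * ?w s)"
          unfolding lhs real_norm_def by linarith
      qed
    qed
  qed
  have "s * (norm (hankel_symbol v (t + s)))\<^sup>2 = (\<Sum>i\<in>UNIV. s * (hankel_symbol v (t + s) $ i)\<^sup>2)" for s
    by (simp add: norm_vec_def L2_set_def sum_nonneg sum_distrib_left)
  then show ?thesis
    by (simp only:) (intro Bochner_Integration.integrable_sum each)
qed

definition kernel :: "real \<Rightarrow> real \<Rightarrow> real" where
  "kernel x y = ((J_mat *v f x) \<bullet> f y) / (x - y)"

lemma f_difference_le:
  assumes a: "a > t" and "x \<ge> a" "y \<ge> a"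
  shows "norm (f x - f y) \<le> CARD('n) * (W_bound * f_bound) / (a - t) * \<bar>x - y\<bar>"
proof (rule norm_bounded_derivative_bound[OF _ _ assms(2,3)])
  fix z assume z: "z \<ge> a"
  then show "(f has_vector_derivative (\<Sum>i\<in>UNIV. (1 / (z - c i)) *\<^sub>R (W i *v f z))) (at z)"
    using a by (intro ode) auto
  have "norm (\<Sum>i\<in>UNIV. (1 / (z - c i)) *\<^sub>R (W i *v f z)) \<le> (\<Sum>i\<in>(UNIV :: 'n set). 1 / (a - t) * (W_bound * f_bound))"
  proof (rule sum_norm_le)
    fix i
    have ci: "0 < a - t" "a - t \<le> z - c i" using c_le[of i] z a by auto
    then have "norm ((1 / (z - c i)) *\<^sub>R (W i *v f z)) = 1 / (z - c i) * norm (W i *v f z)" by simp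
    also have "\<dots> \<le> 1 / (a - t) * (W_bound * f_bound)"
      using ci z a by (intro mult_mono norm_W_f_le frac_le) auto
    finally show "norm ((1 / (z - c i)) *\<^sub>R (W i *v f z)) \<le> 1 / (a - t) * (W_bound * f_bound)" .
  qed
  then show "norm (\<Sum>i\<in>UNIV. (1 / (z - c i)) *\<^sub>R (W i *v f z)) \<le> CARD('n) * (W_bound * f_bound) / (a - t)"
    by simp
qed

text \<open>The integrand is the derivative of \<open>- kernel (x + s) (y + s)\<close> in \<open>s\<close>, by the symmetry of
  \<open>J W\<^sub>i\<close>.  At infinity this tends to \<open>0\<close>, though its denominator stays equal to \<open>x - y\<close>: as \<open>\<langle>J v, v\<rangle> = 0\<close>, the
  numerator is of the order of \<open>f (x + s) - f (y + s)\<close>, that is, of \<open>1 / s\<close>.\<close>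
lemma kernel_integral:
  assumes x: "x > t" and y: "y > t" and neq: "x \<noteq> y"
    and int: "integrable (ray 0) (\<lambda>s. \<Sum>i\<in>UNIV. ((J_mat *v (W i *v f (x + s))) \<bullet> f (y + s)) / ((x + s - c i) * (y + s - c i)))"
  shows "(\<integral>s. (\<Sum>i\<in>UNIV. ((J_mat *v (W i *v f (x + s))) \<bullet> f (y + s)) / ((x + s - c i) * (y + s - c i))) \<partial>ray 0) = kernel x y"
proof -
  define G where "G s = (\<Sum>i\<in>UNIV. ((J_mat *v (W i *v f (x + s))) \<bullet> f (y + s)) / ((x + s - c i) * (y + s - c i)))" for s
  define N where "N s = (J_mat *v f (x + s)) \<bullet> f (y + s)" for s
  define F where "F s = - (N s / (x - y))" for s
  have sd: "((\<lambda>s. f (z + s)) has_vector_derivative (\<Sum>i\<in>UNIV. (1 / (z + s - c i)) *\<^sub>R (W i *v f (z + s)))) (at s)"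
    if "z > t" "s > 0" for z s
    using that by (intro f_shift_derivative) simp
  have "(LBINT s=ereal 0..\<infinity>. G s) = 0 - (- kernel x y)"
  proof (rule interval_integral_FTC_integrable)
    show "(F has_vector_derivative G s) (at s)" if "ereal 0 < ereal s" for s
    proof -
      have s: "s > 0" using that by simp
      let ?dx = "\<Sum>i\<in>UNIV. (1 / (x + s - c i)) *\<^sub>R (W i *v f (x + s))"
      let ?dy = "\<Sum>i\<in>UNIV. (1 / (y + s - c i)) *\<^sub>R (W i *v f (y + s))"
      have "(N has_vector_derivative ((J_mat *v f (x + s)) \<bullet> ?dy + (J_mat *v ?dx) \<bullet> f (y + s))) (at s)"
        unfolding N_def
        by (rule bounded_bilinear.has_vector_derivative[OF bounded_bilinear_inner
              bounded_linear.has_vector_derivative[OF matrix_vector_mul_bounded_linear sd[OF x s]] sd[OF y s]])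
      moreover have "(J_mat *v f (x + s)) \<bullet> ?dy + (J_mat *v ?dx) \<bullet> f (y + s) = - (x - y) * G s"
      proof -
        have "(J_mat *v f (x + s)) \<bullet> ?dy + (J_mat *v ?dx) \<bullet> f (y + s)
            = (\<Sum>i\<in>UNIV. (1 / (x + s - c i) - 1 / (y + s - c i)) * ((J_mat *v (W i *v f (x + s))) \<bullet> f (y + s)))"
          by (simp add: linear_sum[OF matrix_vector_mul_linear] inner_sum_left inner_sum_right
              matrix_vector_mult_scaleR sum.distrib[symmetric] traceless_J_mat[OF trace] left_diff_distrib)
        also have "\<dots> = - (x - y) * G s"
          unfolding G_def sum_distrib_left
        proof (rule sum.cong[OF refl])
          fix i
          have "x + s - c i \<noteq> 0" "y + s - c i \<noteq> 0" using c_le[of i] x y s by auto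
          then have "1 / (x + s - c i) - 1 / (y + s - c i) = - (x - y) / ((x + s - c i) * (y + s - c i))"
            by (simp add: field_simps)
          then show "(1 / (x + s - c i) - 1 / (y + s - c i)) * ((J_mat *v (W i *v f (x + s))) \<bullet> f (y + s))
              = - (x - y) * (((J_mat *v (W i *v f (x + s))) \<bullet> f (y + s)) / ((x + s - c i) * (y + s - c i)))"
            by simp
        qed
        finally show ?thesis .
      qed
      ultimately have "(N has_real_derivative - (x - y) * G s) (at s)"
        by (simp add: has_real_derivative_iff_has_vector_derivative)
      then have "(F has_real_derivative - ((- (x - y) * G s) / (x - y))) (at s)"
        unfolding F_def by (intro DERIV_minus DERIV_cdivide)
      moreover have "- ((- (x - y) * G s) / (x - y)) = G s" using neq by (simp add: field_simps)
      ultimately show ?thesis by (simp only: has_real_derivative_iff_has_vector_derivative)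
    qed
    show "isCont G s" if "ereal 0 < ereal s" for s
    proof -
      have "continuous_on {0<..} (\<lambda>s. f (z + s))" if "z > t" for z
        using that by (intro continuous_on_compose2[OF continuous_on_f] continuous_intros) auto
      moreover have "continuous_on {0<..} (\<lambda>s. A *v k s)" if "continuous_on {0<..} k" for k :: "real \<Rightarrow> real^2" and A :: "real^2^2"
        by (intro continuous_on_compose2[OF matrix_vector_mult_linear_continuous_on that]) auto
      moreover have "(x + s - c i) * (y + s - c i) \<noteq> 0" if "s \<in> {0<..}" for s i
        using c_le[of i] x y that by auto
      ultimately have "continuous_on {0<..} G"
        unfolding G_def using x y by (intro continuous_intros) blast+
      then show ?thesis using that by (simp add: continuous_on_eq_continuous_at)
    qed
    show "set_integrable lborel (einterval (ereal 0) \<infinity>) G"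
      using int by (simp add: G_def[abs_def] integrable_ray_iff del: zero_ereal_def)
    have "isCont (\<lambda>s. f (z + s)) 0" if "z > t" for z
    proof -
      have "isCont (\<lambda>s. z + s) 0" by simp
      from isCont_o2[OF this, where g = f] isCont_f[OF that] show ?thesis by simp
    qed
    then have "isCont F 0"
      unfolding F_def N_def using x y neq
      by (intro continuous_intros isCont_o2[OF _ matrix_vector_mult_linear_continuous_at]) auto
    then have "(F \<longlongrightarrow> F 0) (at_right 0)" by (simp add: isCont_def filterlim_at_split)
    then show "((F \<circ> real_of_ereal) \<longlongrightarrow> - kernel x y) (at_right (ereal 0))"
      by (subst ereal_tendsto_simps1(2)) (simp add: F_def N_def kernel_def)
    define D where "D = CARD('n) * (W_bound * f_bound) * f_bound"
    have "(F \<longlongrightarrow> 0) at_top"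
    proof (rule Lim_null_comparison)
      show "\<forall>\<^sub>F s in at_top. norm (F s) \<le> D / ((min x y - t) + s)"
        using eventually_gt_at_top[of 0]
      proof eventually_elim
        fix s :: real assume s: "s > 0"
        have "norm (f (x + s) - f (y + s)) \<le> CARD('n) * (W_bound * f_bound) / (min x y + s - t) * \<bar>(x + s) - (y + s)\<bar>"
          using x y s by (intro f_difference_le) auto
        moreover have "N s = (J_mat *v (f (x + s) - f (y + s))) \<bullet> f (y + s)"
          by (simp add: N_def matrix_vector_mult_diff_distrib inner_diff_left)
        moreover have "norm (J_mat *v v) = norm v" for v :: "real^2"
          by (simp add: norm_eq inner_real2)
        moreover have "0 \<le> CARD('n) * (W_bound * f_bound) / (min x y + s - t) * \<bar>x - y\<bar>"
          using x y s W_bound_nonneg f_bound_nonneg by (intro mult_nonneg_nonneg divide_nonneg_nonneg) auto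
        ultimately have "\<bar>N s\<bar> \<le> (CARD('n) * (W_bound * f_bound) / (min x y + s - t) * \<bar>x - y\<bar>) * f_bound"
          using x y s norm_f_le[of "y + s"]
          by (auto intro!: order_trans[OF Cauchy_Schwarz_ineq2] mult_mono simp del: times_divide_eq_left)
        then have "\<bar>N s\<bar> / \<bar>x - y\<bar> \<le> (CARD('n) * (W_bound * f_bound) / (min x y + s - t) * \<bar>x - y\<bar>) * f_bound / \<bar>x - y\<bar>"
          by (rule divide_right_mono) simp
        also have "\<dots> = D / ((min x y - t) + s)" 
        proof -
          have shift: "(min x y - t) + s = min x y + s - t" by simp
          show ?thesis unfolding shift D_def using neq by simp
        qed
        finally show "norm (F s) \<le> D / ((min x y - t) + s)" by (simp add: F_def)
      qed
      show "((\<lambda>s. D / ((min x y - t) + s)) \<longlongrightarrow> 0) at_top"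
        by (intro tendsto_divide_0[OF tendsto_const] filterlim_at_top_imp_at_infinity
            filterlim_tendsto_add_at_top[OF tendsto_const] filterlim_ident)
    qed
    then show "((F \<circ> real_of_ereal) \<longlongrightarrow> 0) (at_left \<infinity>)"
      by (simp add: ereal_tendsto_simps1)
  qed simp
  then show ?thesis
    by (simp add: G_def[abs_def] interval_integral_to_infinity_eq integral_restrict_space set_lebesgue_integral_def del: zero_ereal_def)
qed

end
(*END*)

section \<open>Hankel factorisation and trace class property of the kernel\<close>

lemma sum_UNIV_sum_type:
  fixes h :: "'a::finite + 'b::finite \<Rightarrow> 'c::comm_monoid_add"
  shows "(\<Sum>a\<in>UNIV. h a) = (\<Sum>i\<in>UNIV. h (Inl i)) + (\<Sum>j\<in>UNIV. h (Inr j))"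
  by (simp add: UNIV_Plus_UNIV[symmetric] sum.Plus del: UNIV_Plus_UNIV)

definition stack :: "real^'j \<Rightarrow> real^'k \<Rightarrow> real^('j::finite + 'k::finite)" where
  "stack a b = (\<chi> i. case i of Inl j \<Rightarrow> a $ j | Inr j \<Rightarrow> b $ j)"

lemma norm_stack: "(norm (stack a b))\<^sup>2 = (norm a)\<^sup>2 + (norm b)\<^sup>2"
  unfolding power2_norm_eq_inner by (simp add: inner_vec_def sum_UNIV_sum_type stack_def)

lemma sigma_mat_inner_stack:
  fixes a c :: "real^'j::finite" and b d :: "real^'k::finite"
  shows "(sigma_mat *v stack a b) \<bullet> stack c d = a \<bullet> c - b \<bullet> d"
proof -
  have "(sigma_mat *v v) $ Inl j = v $ Inl j" "(sigma_mat *v v) $ Inr k = - v $ Inr k" for v :: "real^('j + 'k)" and j k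
    by (simp_all add: sigma_mat_def matrix_vector_mult_def if_distrib[of "\<lambda>x. x * _"] cong: if_cong)
  then show ?thesis
    by (simp add: inner_vec_def sum_UNIV_sum_type stack_def sum_negf)
qed

lemma continuous_on_stack:
  assumes "continuous_on S a" "continuous_on S b"
  shows "continuous_on S (\<lambda>x. stack (a x) (b x))"
  unfolding stack_def
proof (rule continuous_on_vec_lambda)
  show "continuous_on S (\<lambda>x. case i of Inl j \<Rightarrow> a x $ j | Inr j \<Rightarrow> b x $ j)" for i
    using assms by (cases i) (auto intro!: continuous_intros)
qed

context fuchsian_solution
begin

lemma signature:
  "\<exists>P Q. \<forall>i x y. (J_mat *v (W i *v x)) \<bullet> y
     = (P i \<bullet> (W i *v x)) * (P i \<bullet> (W i *v y)) - (Q i \<bullet> (W i *v x)) * (Q i \<bullet> (W i *v y))"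
  using traceless_signature[OF trace det] by metis

lemma hankel_symbol_inner_difference:
  assumes "\<And>i x y. (J_mat *v (W i *v x)) \<bullet> y
           = (P i \<bullet> (W i *v x)) * (P i \<bullet> (W i *v y)) - (Q i \<bullet> (W i *v x)) * (Q i \<bullet> (W i *v y))"
  shows "hankel_symbol P x \<bullet> hankel_symbol P y - hankel_symbol Q x \<bullet> hankel_symbol Q y
       = (\<Sum>i\<in>UNIV. ((J_mat *v (W i *v f x)) \<bullet> f y) / ((x - c i) * (y - c i)))"
proof -
  have "u \<bullet> v = (\<Sum>i\<in>UNIV. u $ i * v $ i)" for u v :: "real^'n"
    by (simp add: inner_vec_def)
  then show ?thesis
    by (simp add: hankel_symbol_def assms diff_divide_distrib sum_subtractf)
qed

lemma hankel_symbol_integrable: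
  assumes "x > t" "y > t"
  shows "integrable (ray 0) (\<lambda>s. hankel_symbol v (x + s) \<bullet> hankel_symbol v (y + s))"
  using hankel_symbol_le[of v] gram_integrable[OF continuous_on_hankel_symbol _ assms] by blast

lemma kernel_eq_gram_difference:
  assumes PQ: "\<And>i x y. (J_mat *v (W i *v x)) \<bullet> y
           = (P i \<bullet> (W i *v x)) * (P i \<bullet> (W i *v y)) - (Q i \<bullet> (W i *v x)) * (Q i \<bullet> (W i *v y))"
    and xy: "x > t" "y > t" "x \<noteq> y"
  shows "has_bochner_integral (ray 0)
           (\<lambda>s. hankel_symbol P (x + s) \<bullet> hankel_symbol P (y + s) - hankel_symbol Q (x + s) \<bullet> hankel_symbol Q (y + s)) (kernel x y)"
    and "kernel x y = gram (hankel_symbol P) x y - gram (hankel_symbol Q) x y"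
proof -
  have i: "integrable (ray 0) (\<lambda>s. hankel_symbol P (x + s) \<bullet> hankel_symbol P (y + s) - hankel_symbol Q (x + s) \<bullet> hankel_symbol Q (y + s))"
    using hankel_symbol_integrable[OF xy(1,2)] by (intro Bochner_Integration.integrable_diff)
  then have "(\<integral>s. hankel_symbol P (x + s) \<bullet> hankel_symbol P (y + s) - hankel_symbol Q (x + s) \<bullet> hankel_symbol Q (y + s) \<partial>ray 0) = kernel x y"
    unfolding hankel_symbol_inner_difference[OF PQ] by (intro kernel_integral xy)
  with i show "has_bochner_integral (ray 0)
           (\<lambda>s. hankel_symbol P (x + s) \<bullet> hankel_symbol P (y + s) - hankel_symbol Q (x + s) \<bullet> hankel_symbol Q (y + s)) (kernel x y)"
    by (simp add: has_bochner_integral_iff)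
  then show "kernel x y = gram (hankel_symbol P) x y - gram (hankel_symbol Q) x y"
    using hankel_symbol_integrable[OF xy(1,2)] by (simp add: gram_def has_bochner_integral_iff)
qed

text \<open>The two Hankel symbols are stacked, and \<open>sigma_mat\<close> attaches the signs of the two squares.\<close>
theorem kernel_hankel_factorisation:
  "\<exists>\<phi> :: real \<Rightarrow> real^('n + 'n).
     (\<lambda>s. \<phi> (t + s)) \<in> L2_space (density (ray 0) (\<lambda>s. ennreal s)) \<and>
     (\<forall>x>t. \<forall>y>t. x \<noteq> y \<longrightarrow>
        has_bochner_integral (ray 0) (\<lambda>s. (sigma_mat *v \<phi> (x + s)) \<bullet> \<phi> (y + s)) (kernel x y))"
proof -
  obtain P Q where PQ: "\<And>i x y. (J_mat *v (W i *v x)) \<bullet> y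
           = (P i \<bullet> (W i *v x)) * (P i \<bullet> (W i *v y)) - (Q i \<bullet> (W i *v x)) * (Q i \<bullet> (W i *v y))"
    using signature by blast
  define \<phi> :: "real \<Rightarrow> real^('n + 'n)" where "\<phi> x = stack (hankel_symbol P x) (hankel_symbol Q x)" for x
  have "continuous_on {t<..} \<phi>"
    unfolding \<phi>_def[abs_def] by (intro continuous_on_stack continuous_on_hankel_symbol)
  then have "continuous_on {0<..} (\<lambda>s. \<phi> (t + s))"
    by (rule continuous_on_compose2) (auto intro!: continuous_intros)
  then have meas: "(\<lambda>s. \<phi> (t + s)) \<in> borel_measurable (ray 0)"
    by (rule measurable_ray_continuous)
  have id [measurable]: "(\<lambda>s. s) \<in> borel_measurable (ray 0)"
    by (rule measurable_ray_continuous) (rule continuous_on_id)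
  have "integrable (ray 0) (\<lambda>s. s * (norm (\<phi> (t + s)))\<^sup>2)"
    using hankel_symbol_weight_integrable by (simp add: \<phi>_def norm_stack distrib_left)
  then have "integrable (density (ray 0) (\<lambda>s. ennreal s)) (\<lambda>s. (norm (\<phi> (t + s)))\<^sup>2)"
    using meas id by (subst integrable_density) (auto intro!: AE_I2 simp: space_restrict_space)
  then have "(\<lambda>s. \<phi> (t + s)) \<in> L2_space (density (ray 0) (\<lambda>s. ennreal s))"
    using meas by (simp add: L2_space_def)
  moreover have "(sigma_mat *v \<phi> x) \<bullet> \<phi> y = hankel_symbol P x \<bullet> hankel_symbol P y - hankel_symbol Q x \<bullet> hankel_symbol Q y" for x y
    unfolding \<phi>_def by (rule sigma_mat_inner_stack)
  ultimately show ?thesis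
    using kernel_eq_gram_difference(1)[OF PQ] by (intro exI[of _ \<phi>] conjI allI impI) simp_all
qed

theorem kernel_trace_class: "trace_class_kernel (ray t) kernel"
proof -
  obtain P Q where PQ: "\<And>i x y. (J_mat *v (W i *v x)) \<bullet> y
           = (P i \<bullet> (W i *v x)) * (P i \<bullet> (W i *v y)) - (Q i \<bullet> (W i *v x)) * (Q i \<bullet> (W i *v y))"
    using signature by blast
  obtain CP where CP: "\<And>x. x > t \<Longrightarrow> norm (hankel_symbol P x) \<le> CP / (x - t)"
    using hankel_symbol_le[of P] by blast
  obtain CQ where CQ: "\<And>x. x > t \<Longrightarrow> norm (hankel_symbol Q x) \<le> CQ / (x - t)"
    using hankel_symbol_le[of Q] by blast
  show ?thesis
  proof (rule trace_class_psd_difference)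
    have f1: "(\<lambda>z. f (fst z)) \<in> borel_measurable (ray t \<Otimes>\<^sub>M ray t)"
      and f2: "(\<lambda>z. f (snd z)) \<in> borel_measurable (ray t \<Otimes>\<^sub>M ray t)"
      using measurable_ray_continuous[OF continuous_on_f] by measurable
    have id [measurable]: "(\<lambda>s. s) \<in> borel_measurable (ray t)"
      by (rule measurable_ray_continuous) (rule continuous_on_id)
    have "(\<lambda>z. J_mat *v f (fst z)) \<in> borel_measurable (ray t \<Otimes>\<^sub>M ray t)"
      by (rule measurable_compose[OF f1 borel_measurable_continuous_onI[OF matrix_vector_mult_linear_continuous_on]])
    with f2 show "(\<lambda>(x, y). kernel x y) \<in> borel_measurable (ray t \<Otimes>\<^sub>M ray t)"
      unfolding kernel_def split_beta by measurable
    show "kernel x y = gram (hankel_symbol P) x y - gram (hankel_symbol Q) x y" if "x \<in> {t<..}" "y \<in> {t<..}" "x \<noteq> y" for x y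
      using kernel_eq_gram_difference(2)[OF PQ] that by simp
  qed (simp_all add: psd_kernel_gram[OF continuous_on_hankel_symbol CP] psd_kernel_gram[OF continuous_on_hankel_symbol CQ]
      continuous_on_gram[OF continuous_on_hankel_symbol CP] continuous_on_gram[OF continuous_on_hankel_symbol CQ]
      gram_diagonal_integrable[OF continuous_on_hankel_symbol CP hankel_symbol_weight_integrable]
      gram_diagonal_integrable[OF continuous_on_hankel_symbol CQ hankel_symbol_weight_integrable])
qed

end

section \<open>The kernel of the Jimbo-Miwa-Ueno system\<close>

text \<open>By the symmetry of \<open>J A\<close> the two terms of the product rule combine to a multiple of
  \<open>1 / (y - t) - 1 / (x - t)\<close>, and the factor \<open>x - y\<close> cancels.\<close>
lemma K_kernel_t_derivative:
  fixes \<Phi> :: "real \<Rightarrow> real \<Rightarrow> real^2"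
  assumes tr: "A $ 1 $ 1 + A $ 2 $ 2 = 0" and x: "x > t" and y: "y > t" and neq: "x \<noteq> y"
    and dx: "((\<lambda>\<tau>. \<Phi> x \<tau>) has_vector_derivative ((- (1 / (x - t))) *\<^sub>R A) *v \<Phi> x t) (at t)"
    and dy: "((\<lambda>\<tau>. \<Phi> y \<tau>) has_vector_derivative ((- (1 / (y - t))) *\<^sub>R A) *v \<Phi> y t) (at t)"
  shows "((\<lambda>\<tau>. K_kernel \<Phi> x y \<tau>) has_real_derivative
           ((J_mat *v (A *v \<Phi> x t)) \<bullet> \<Phi> y t) / ((x - t) * (y - t))) (at t)"
proof -
  let ?S = "(J_mat *v (A *v \<Phi> x t)) \<bullet> \<Phi> y t"
  have "((\<lambda>\<tau>. (J_mat *v \<Phi> x \<tau>) \<bullet> \<Phi> y \<tau>) has_vector_derivative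
      ((J_mat *v \<Phi> x t) \<bullet> (((- (1 / (y - t))) *\<^sub>R A) *v \<Phi> y t)
       + (J_mat *v (((- (1 / (x - t))) *\<^sub>R A) *v \<Phi> x t)) \<bullet> \<Phi> y t)) (at t)"
    by (rule bounded_bilinear.has_vector_derivative[OF bounded_bilinear_inner
          bounded_linear.has_vector_derivative[OF matrix_vector_mul_bounded_linear dx] dy])
  moreover have "(J_mat *v \<Phi> x t) \<bullet> (((- (1 / (y - t))) *\<^sub>R A) *v \<Phi> y t)
       + (J_mat *v (((- (1 / (x - t))) *\<^sub>R A) *v \<Phi> x t)) \<bullet> \<Phi> y t
      = ?S / (y - t) - ?S / (x - t)"
  proof -
    have scale: "(a *\<^sub>R A) *v v = a *\<^sub>R (A *v v)" for a v
      by (simp add: scaleR_matrix_vector_assoc)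
    show ?thesis
      unfolding scale matrix_vector_mult_scaleR by (simp add: traceless_J_mat[OF tr])
  qed
  ultimately have "((\<lambda>\<tau>. (J_mat *v \<Phi> x \<tau>) \<bullet> \<Phi> y \<tau>) has_real_derivative ?S / (y - t) - ?S / (x - t)) (at t)"
    by (simp add: has_real_derivative_iff_has_vector_derivative)
  then have "((\<lambda>\<tau>. K_kernel \<Phi> x y \<tau>) has_real_derivative (?S / (y - t) - ?S / (x - t)) / (x - y)) (at t)"
    unfolding K_kernel_def by (rule DERIV_cdivide)
  moreover have "(?S / (y - t) - ?S / (x - t)) / (x - y) = ?S / ((x - t) * (y - t))"
    using x y neq by (simp add: divide_simps) (simp add: algebra_simps)
  ultimately show ?thesis by simp
qed

lemma W_mat_trace: "W_mat \<theta> z u $ 1 $ 1 + W_mat \<theta> z u $ 2 $ 2 = 0"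
  by (simp add: W_mat_def)

lemma W_mat_det: "u \<noteq> 0 \<Longrightarrow> det (W_mat \<theta> z u) = - (\<theta> / 2)\<^sup>2"
  by (simp add: W_mat_def det_2 power2_eq_square field_simps)

theorem theorem3p3:
  fixes \<theta>0 \<theta>1 \<theta>t :: real
    and \<theta>inf :: complex
    and z0 z1 zt u0 u1 ut :: "real \<Rightarrow> real"
    and W0 W1 Wt :: "real \<Rightarrow> real^2^2"
    and \<Phi> :: "real \<Rightarrow> real \<Rightarrow> real^2"
    and T :: "real set"
  assumes T: "open T" "T \<subseteq> {1<..}"
    and u_nonzero: "\<forall>t\<in>T. u0 t \<noteq> 0 \<and> u1 t \<noteq> 0 \<and> ut t \<noteq> 0"
    and W0: "\<forall>t\<in>T. W0 t = W_mat \<theta>0 (z0 t) (u0 t)"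
    and W1: "\<forall>t\<in>T. W1 t = W_mat \<theta>1 (z1 t) (u1 t)"
    and Wt: "\<forall>t\<in>T. Wt t = W_mat \<theta>t (zt t) (ut t)"
    and Winf: "\<forall>t\<in>T. complex_eigenvalues (- (W0 t + W1 t + Wt t)) = {- \<theta>inf / 2, \<theta>inf / 2}"
    and theta_inf: "\<forall>n::nat. n > 0 \<longrightarrow> \<theta>inf \<noteq> of_nat n \<and> - \<theta>inf \<noteq> of_nat n"
    and lambda_equation: "\<forall>t\<in>T. \<forall>x>t.
          ((\<lambda>l. \<Phi> l t) has_vector_derivative
             (((1 / x) *\<^sub>R W0 t + (1 / (x - 1)) *\<^sub>R W1 t + (1 / (x - t)) *\<^sub>R Wt t) *v \<Phi> x t)) (at x)"
    and bounded: "\<forall>t\<in>T. bounded ((\<lambda>x. \<Phi> x t) ` {t<..})"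
    and L2: "\<forall>t\<in>T. (\<lambda>x. \<Phi> x t) \<in>
          L2_space (density (restrict_space lborel {t<..}) (\<lambda>x. ennreal (1 / x)))"
  shows "(\<forall>t\<in>T.
            (\<exists>\<phi> :: real \<Rightarrow> real^(3 + 3).
               (\<lambda>s. \<phi> (t + s)) \<in> L2_space (density (restrict_space lborel {0<..}) (\<lambda>s. ennreal s)) \<and>
               (\<forall>x>t. \<forall>y>t. x \<noteq> y \<longrightarrow>
                  has_bochner_integral (restrict_space lborel {0<..})
                    (\<lambda>s. (sigma_mat *v \<phi> (x + s)) \<bullet> \<phi> (y + s)) (K_kernel \<Phi> x y t))) \<and>
            trace_class_kernel (restrict_space lborel {t<..}) (\<lambda>x y. K_kernel \<Phi> x y t)) \<and>
         ((\<forall>t\<in>T. \<forall>x>t.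
             ((\<lambda>\<tau>. \<Phi> x \<tau>) has_vector_derivative ((- (1 / (x - t))) *\<^sub>R Wt t) *v \<Phi> x t) (at t)) \<longrightarrow>
          (\<forall>t\<in>T.
             (\<forall>x>t. \<forall>y>t. x \<noteq> y \<longrightarrow> (\<lambda>\<tau>. K_kernel \<Phi> x y \<tau>) differentiable (at t)) \<and>
             finite_rank_off_diagonal {t<..} (\<lambda>x y. deriv (\<lambda>\<tau>. K_kernel \<Phi> x y \<tau>) t)))"
proof (intro conjI impI ballI)
  fix t assume t: "t \<in> T"
  have t1: "t > 1" using t T by auto
  define W :: "3 \<Rightarrow> real^2^2" where "W i = (if i = 1 then W0 t else if i = 2 then W1 t else Wt t)" for i
  define c :: "3 \<Rightarrow> real" where "c i = (if i = 1 then 0 else if i = 2 then 1 else t)" for i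
  have Ws: "W 1 = W0 t" "W 2 = W1 t" "W 3 = Wt t" and cs: "c 1 = 0" "c 2 = 1" "c 3 = t"
    by (simp_all add: W_def c_def)
  have W_cases: "\<exists>\<theta> z u. u \<noteq> 0 \<and> W i = W_mat \<theta> z u" for i
    using t u_nonzero W0 W1 Wt by (auto simp: W_def)
  interpret fuchsian_solution W c 3 t "\<lambda>x. \<Phi> x t"
  proof
    show "W i $ 1 $ 1 + W i $ 2 $ 2 = 0" "det (W i) \<le> 0" for i
      using W_cases[of i] by (auto simp: W_mat_trace W_mat_det)
    show "c 3 = t" by (rule cs)
    show "c i < t" if "i \<noteq> 3" for i using that exhaust_3[of i] t1 by (auto simp: cs)
    show "t > 0" using t1 by simp
    show "((\<lambda>x. \<Phi> x t) has_vector_derivative (\<Sum>i\<in>UNIV. (1 / (x - c i)) *\<^sub>R (W i *v \<Phi> x t))) (at x)"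
      if "x > t" for x
    proof -
      have "(\<Sum>i\<in>UNIV. (1 / (x - c i)) *\<^sub>R (W i *v \<Phi> x t))
          = ((1 / x) *\<^sub>R W0 t + (1 / (x - 1)) *\<^sub>R W1 t + (1 / (x - t)) *\<^sub>R Wt t) *v \<Phi> x t"
        unfolding sum_3 Ws cs by (simp only: matrix_vector_mult_add_rdistrib scaleR_matrix_vector_assoc diff_zero)
      with lambda_equation t that show ?thesis by simp
    qed
    show "bounded ((\<lambda>x. \<Phi> x t) ` {t<..})" using bounded t by simp
    have inv: "(\<lambda>x. 1 / x) \<in> borel_measurable (ray t)"
      using t1 by (intro measurable_ray_continuous continuous_intros) auto
    have \<Phi>: "(\<lambda>x. \<Phi> x t) \<in> borel_measurable (ray t)"
      "integrable (density (ray t) (\<lambda>x. ennreal (1 / x))) (\<lambda>x. (norm (\<Phi> x t))\<^sup>2)"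
      using L2 t by (auto simp: L2_space_def)
    have "integrable (density (ray t) (\<lambda>x. ennreal (1 / x))) (\<lambda>x. (norm (\<Phi> x t))\<^sup>2)
        \<longleftrightarrow> integrable (ray t) (\<lambda>x. (1 / x) *\<^sub>R (norm (\<Phi> x t))\<^sup>2)"
    proof (rule integrable_density[OF _ inv])
      show "(\<lambda>x. (norm (\<Phi> x t))\<^sup>2) \<in> borel_measurable (ray t)" using \<Phi>(1) by measurable
      show "AE x in ray t. 0 \<le> 1 / x" using t1 by (auto simp: space_restrict_space)
    qed
    with \<Phi>(2) show "integrable (ray t) (\<lambda>x. (norm (\<Phi> x t))\<^sup>2 / x)" by simp
  qed
  have kernel: "kernel = (\<lambda>x y. K_kernel \<Phi> x y t)"
    by (simp add: fun_eq_iff kernel_def K_kernel_def)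
  show "\<exists>\<phi> :: real \<Rightarrow> real^(3 + 3).
          (\<lambda>s. \<phi> (t + s)) \<in> L2_space (density (ray 0) (\<lambda>s. ennreal s)) \<and>
          (\<forall>x>t. \<forall>y>t. x \<noteq> y \<longrightarrow>
            has_bochner_integral (ray 0) (\<lambda>s. (sigma_mat *v \<phi> (x + s)) \<bullet> \<phi> (y + s)) (K_kernel \<Phi> x y t))"
    using kernel_hankel_factorisation by (simp only: kernel)
  show "trace_class_kernel (ray t) (\<lambda>x y. K_kernel \<Phi> x y t)"
    using kernel_trace_class by (simp only: kernel)
next
  fix t assume t_eq: "\<forall>t\<in>T. \<forall>x>t. ((\<lambda>\<tau>. \<Phi> x \<tau>) has_vector_derivative ((- (1 / (x - t))) *\<^sub>R Wt t) *v \<Phi> x t) (at t)"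
    and t: "t \<in> T"
  have tr: "Wt t $ 1 $ 1 + Wt t $ 2 $ 2 = 0" using Wt t by (simp add: W_mat_trace)
  have deriv: "((\<lambda>\<tau>. K_kernel \<Phi> x y \<tau>) has_real_derivative
      ((J_mat *v (Wt t *v \<Phi> x t)) \<bullet> \<Phi> y t) / ((x - t) * (y - t))) (at t)"
    if "x > t" "y > t" "x \<noteq> y" for x y
    using t_eq t that by (intro K_kernel_t_derivative tr) auto
  show "\<forall>x>t. \<forall>y>t. x \<noteq> y \<longrightarrow> (\<lambda>\<tau>. K_kernel \<Phi> x y \<tau>) differentiable (at t)"
    using deriv unfolding real_differentiable_def by blast
  have split: "((J_mat *v (Wt t *v \<Phi> x t)) \<bullet> \<Phi> y t) / ((x - t) * (y - t))
      = (\<Sum>i<2::nat. ((J_mat *v (Wt t *v \<Phi> x t)) $ (if i = 0 then 1 else 2) / (x - t))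
               * (\<Phi> y t $ (if i = 0 then 1 else 2) / (y - t)))" for x y
    by (simp add: inner_real2 numeral_2_eq_2 diff_divide_distrib)
  show "finite_rank_off_diagonal {t<..} (\<lambda>x y. deriv (\<lambda>\<tau>. K_kernel \<Phi> x y \<tau>) t)"
    unfolding finite_rank_off_diagonal_def
  proof (rule exI[of _ "2::nat"],
      rule exI[of _ "\<lambda>i x. (J_mat *v (Wt t *v \<Phi> x t)) $ (if i = 0 then 1 else 2) / (x - t)"],
      rule exI[of _ "\<lambda>i y. \<Phi> y t $ (if i = 0 then 1 else 2) / (y - t)"], intro ballI impI)
    fix x y assume "x \<in> {t<..}" "y \<in> {t<..}" "x \<noteq> y"
    then show "deriv (\<lambda>\<tau>. K_kernel \<Phi> x y \<tau>) t
        = (\<Sum>i<2::nat. ((J_mat *v (Wt t *v \<Phi> x t)) $ (if i = 0 then 1 else 2) / (x - t))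
               * (\<Phi> y t $ (if i = 0 then 1 else 2) / (y - t)))"
      using DERIV_imp_deriv[OF deriv, of x y] split[of x y] by simp
  qed
qed

end
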